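(* Under the standing assumptions below, let $c\in\mathcal{C}_{n-1}(n,q)$ with $\mathrm{wt}(c)\leq W(n,q)$ and suppose $|\mathbb{H}_c^\infty|=1$. Then $c$ is minimal.
   Context: Standing assumptions: $p$ is a prime, $q=p^h$ with $h\geq 2$, $q>27$, $n\geq 2$, and $q\geq\max\{32,2^{2n-4}\}$ if $h>2$, while $q\geq 2^{2n}$ if $h=2$. $\mathrm{PG}(n,q)$ is the Desarguesian projective space over $\mathbb{F}_q$; $\theta_m:=\frac{q^{m+1}-1}{q-1}$. $\mathcal{C}_{n-1}(n,q)$ is the $\mathbb{F}_p$-span of the characteristic functions (values in $\mathbb{F}_p$) of the hyperplanes of $\mathrm{PG}(n,q)$, as functions on points; hyperplanes are identified with their characteristic functions. $\mathrm{supp}(c)=\{P:c(P)\neq0\}$, $\mathrm{wt}(c)=|\mathrm{supp}(c)|$, $m_c:=\lceil\mathrm{wt}(c)/\theta_{n-1}\rceil$. $\Delta_{n,q}:=\lfloor 2^{-(n-2)}\sqrt{q}\rfloor$ if $h>2$, $\Delta_{n,q}:=\lfloor p/2^n\rfloor$ if $h=2$; $W(n,q):=(\Delta_{n,q}-1)\theta_{n-1}$. For $c$ with $\mathrm{wt}(c)\leq W(n,q)$, $c$ is a linear combination with nonzero coefficients of a uniquely determined set $\mathcal{H}_c$ of exactly $m_c$ distinct hyperplanes, with uniquely determined coefficients; write $c(H)$ for the coefficient of $H\in\mathcal{H}_c$ and $c(H):=0$ for hyperplanes $H\notin\mathcal{H}_c$. For $\mathcal{H}\subseteq\mathcal{H}_c$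 put $c|_{\mathcal{H}}:=\sum_{H\in\mathcal{H}}c(H)H$. Points of $\mathrm{supp}(c)$ are real points of $c$; other points are holes of $c$. For a partition $\mathbb{H}$ of $\mathcal{H}_c$, let $\Gamma_{\mathbb{H}}$ be the graph with vertex set $\mathbb{H}$ in which distinct $\mathcal{H}_1,\mathcal{H}_2$ are adjacent iff there is a point $P$ such that: $P$ is a hole of $c$; $c|_{\mathcal{H}_1}(P)\neq0$ and $c|_{\mathcal{H}_2}(P)\neq0$; and $c|_{\mathcal{H}}(P)=0$ for all $\mathcal{H}\in\mathbb{H}\setminus\{\mathcal{H}_1,\mathcal{H}_2\}$. Let $\mathbb{H}_c^0$ be the partition of $\mathcal{H}_c$ into singletons, and for $i\geq0$ let $\mathbb{H}_c^{i+1}$ be the partition whose parts are the unions $\bigcup_{\mathcal{H}\in\mathbb{C}}\mathcal{H}$ over the vertex sets $\mathbb{C}$ of the connected components of $\Gamma_{\mathbb{H}_c^i}$. This sequence stabilizes; $\mathbb{H}_c^\infty$ denotes the eventual constant partition. A codeword $c$ is minimal if for every $c'\in\mathcal{C}_{n-1}(n,q)$ with $\mathrm{supp}(c')\subseteq\mathrm{supp}(c)$ there is $\alpha\in\mathbb{F}_p$ with $c'=\alpha c$. *)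

theory Defs
  imports "HOL-Analysis.Analysis" "HOL-Library.Function_Algebras"
    "HOL-Computational_Algebra.Primes"
begin

text \<open>The space PG(n,q) is modelled on the vector space \<open>'a ^ 'n\<close>, where \<open>'a\<close> is a field with
  q elements and \<open>'n\<close> has n + 1 elements.  Points and hyperplanes are linear subspaces, and incidence
  is inclusion.\<close>

definition pg_points :: "('a::field ^ 'n) set set" where
  "pg_points = {P. vec.subspace P \<and> vec.dim P = 1}"

definition pg_hyperplanes :: "('a::field ^ 'n) set set" where
  "pg_hyperplanes = {H. vec.subspace H \<and> vec.dim H = CARD('n) - 1}"

definition theta :: "nat \<Rightarrow> nat \<Rightarrow> nat" where
  "theta q m = (q ^ (m + 1) - 1) div (q - 1)"

definition fscale :: "'f::field \<Rightarrow> ('x \<Rightarrow> 'f) \<Rightarrow> 'x \<Rightarrow> 'f" where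
  "fscale k f = (\<lambda>x. k * f x)"

interpretation fun_space: vector_space "fscale :: 'f::field \<Rightarrow> ('x \<Rightarrow> 'f) \<Rightarrow> 'x \<Rightarrow> 'f"
  by unfold_locales (simp_all add: fscale_def fun_eq_iff algebra_simps)

text \<open>Functions on points are total functions on sets of vectors.  The functions \<open>hchar H\<close>, and hence
  all codewords, vanish on arguments that are not points.\<close>

definition hchar :: "('a::field ^ 'n) set \<Rightarrow> ('a ^ 'n) set \<Rightarrow> 'f::field" where
  "hchar H P = (if P \<in> pg_points \<and> P \<subseteq> H then 1 else 0)"

definition pg_code :: "(('a::field ^ 'n) set \<Rightarrow> 'f::field) set" where
  "pg_code = fun_space.span (hchar ` pg_hyperplanes)"

definition supp :: "(('a::field ^ 'n) set \<Rightarrow> 'f::field) \<Rightarrow> ('a ^ 'n) set set" where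
  "supp c = {P \<in> pg_points. c P \<noteq> 0}"

definition wt :: "(('a::field ^ 'n) set \<Rightarrow> 'f::field) \<Rightarrow> nat" where
  "wt c = card (supp c)"

definition holes :: "(('a::field ^ 'n) set \<Rightarrow> 'f::field) \<Rightarrow> ('a ^ 'n) set set" where
  "holes c = pg_points - supp c"

definition minimal_codeword :: "(('a::field ^ 'n) set \<Rightarrow> 'f::field) \<Rightarrow> bool" where
  "minimal_codeword c \<longleftrightarrow>
    (\<forall>c' \<in> pg_code. supp c' \<subseteq> supp c \<longrightarrow> (\<exists>\<alpha>. c' = fscale \<alpha> c))"

text \<open>The index \<open>CARD('n) - 2\<close> is n - 1.\<close>

definition mnum :: "(('a::field ^ 'n) set \<Rightarrow> 'f::field) \<Rightarrow> nat" where
  "mnum c = nat \<lceil>real (wt c) / real (theta CARD('a) (CARD('n) - 2))\<rceil>"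

definition Delta :: "nat \<Rightarrow> nat \<Rightarrow> nat \<Rightarrow> int" where
  "Delta p h n =
    (if h > 2 then \<lfloor>sqrt (real (p ^ h)) / 2 ^ (n - 2)\<rfloor> else \<lfloor>real p / 2 ^ n\<rfloor>)"

definition Wbound :: "nat \<Rightarrow> nat \<Rightarrow> nat \<Rightarrow> int" where
  "Wbound p h n = (Delta p h n - 1) * int (theta (p ^ h) (n - 1))"

text \<open>A representation of \<open>c\<close> as a combination, with nonzero coefficients, of exactly \<open>mnum c\<close>
  distinct hyperplanes is encoded by its coefficient function, extended by 0.\<close>

definition hyp_rep ::
    "(('a::field ^ 'n) set \<Rightarrow> 'f::field) \<Rightarrow> (('a ^ 'n) set \<Rightarrow> 'f) \<Rightarrow> bool" where
  "hyp_rep c a \<longleftrightarrow>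
    {H. a H \<noteq> 0} \<subseteq> pg_hyperplanes \<and> card {H. a H \<noteq> 0} = mnum c \<and>
    c = (\<Sum>H\<in>{H. a H \<noteq> 0}. fscale (a H) (hchar H))"

text \<open>For codewords of weight at most W(n,q) there is exactly one representation;
  the default value 0 is only a totalization for other functions.\<close>

definition hyp_coeff :: "(('a::field ^ 'n) set \<Rightarrow> 'f::field) \<Rightarrow> ('a ^ 'n) set \<Rightarrow> 'f" where
  "hyp_coeff c = (if \<exists>!a. hyp_rep c a then (THE a. hyp_rep c a) else (\<lambda>_. 0))"

definition hyp_set :: "(('a::field ^ 'n) set \<Rightarrow> 'f::field) \<Rightarrow> ('a ^ 'n) set set" where
  "hyp_set c = {H. hyp_coeff c H \<noteq> 0}"

definition restr ::
    "(('a::field ^ 'n) set \<Rightarrow> 'f::field) \<Rightarrow> ('a ^ 'n) set set \<Rightarrow> ('a ^ 'n) set \<Rightarrow> 'f" where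
  "restr c \<H> = (\<Sum>H\<in>\<H>. fscale (hyp_coeff c H) (hchar H))"

definition part_edges ::
    "(('a::field ^ 'n) set \<Rightarrow> 'f::field) \<Rightarrow> ('a ^ 'n) set set set \<Rightarrow> ('a ^ 'n) set set rel" where
  "part_edges c \<P> = {(X, Y). X \<in> \<P> \<and> Y \<in> \<P> \<and> X \<noteq> Y \<and>
     (\<exists>P \<in> holes c. restr c X P \<noteq> 0 \<and> restr c Y P \<noteq> 0 \<and>
        (\<forall>Z \<in> \<P> - {X, Y}. restr c Z P = 0))}"

text \<open>The edge relation is symmetric, so the classes of its reflexive transitive closure on the
  vertex set are the vertex sets of the connected components.\<close>

definition part_step ::
    "(('a::field ^ 'n) set \<Rightarrow> 'f::field) \<Rightarrow> ('a ^ 'n) set set set \<Rightarrow> ('a ^ 'n) set set set" where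
  "part_step c \<P> = Union ` (\<P> // (part_edges c \<P>)\<^sup>*)"

definition part_seq ::
    "(('a::field ^ 'n) set \<Rightarrow> 'f::field) \<Rightarrow> nat \<Rightarrow> ('a ^ 'n) set set set" where
  "part_seq c i = (part_step c ^^ i) ((\<lambda>H. {H}) ` hyp_set c)"

definition part_limit ::
    "(('a::field ^ 'n) set \<Rightarrow> 'f::field) \<Rightarrow> ('a ^ 'n) set set set" where
  "part_limit c = (THE \<P>. \<forall>\<^sub>F i in sequentially. part_seq c i = \<P>)"

end

theory Submission
  imports Defs "Jordan_Normal_Form.Determinant" "HOL-Number_Theory.Residues"
begin

text \<open>Let \<open>c'\<close> be a codeword with \<open>supp c' \<subseteq> supp c\<close>.  Its support is covered by the m hyperplanes of
  \<open>c\<close>, and the main point is that \<open>c'\<close> is then a combination of these hyperplanes.  This rests on a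
  determinant form of the Szonyi-Weiner inequality: if a line carries s nonzero values of a codeword,
  then \<open>q s \<le> s (s - 1) + t\<close>, where t counts the nonzero values in an affine chart of a plane
  through that line.  As \<open>(m + 1)^2 \<le> q\<close>, s is either at most m or very large.  Subtracting the most
  frequent value on each line in which a covering hyperplane meets a plane therefore leaves a codeword
  of the plane with fewer than q nonzero values, which vanishes.  So \<open>c'\<close> is constant on the points
  lying on exactly one covering hyperplane, and the hyperplanes can be subtracted one by one.

  Once \<open>c'\<close> is a combination of the hyperplanes of \<open>c\<close>, its coefficients are proportional to those of
  \<open>c\<close> on each part of the i-th partition, by induction on i.\<close>

section \<open>Hankel determinants of moments\<close>

text \<open>Each term of the Leibniz expansion contains exactly one entry from every column.\<close>

lemma det_dvd_prod_columns:
  fixes A :: "'a::comm_ring_1 Matrix.mat"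
  assumes A: "A \<in> carrier_mat n n"
    and dvd: "\<And>i j. i < n \<Longrightarrow> j < n \<Longrightarrow> d j dvd A $$ (i, j)"
  shows "(\<Prod>j = 0..<n. d j) dvd Determinant.det A"
  unfolding det_def'[OF A]
proof (rule dvd_sum, rule dvd_mult)
  fix p assume p: "p \<in> {p. p permutes {0..<n}}"
  have "(\<Prod>j = 0..<n. d j) = (\<Prod>i = 0..<n. d (p i))"
    using p prod.permute[of p "{0..<n}" d] by (simp add: comp_def)
  also have "\<dots> dvd (\<Prod>i = 0..<n. A $$ (i, p i))"
    using p by (intro prod_dvd_prod dvd) (auto dest: permutes_in_image)
  finally show "(\<Prod>j = 0..<n. d j) dvd (\<Prod>i = 0..<n. A $$ (i, p i))" .
qed

text \<open>The Leibniz term of a permutation \<open>p\<close> has degree at most the sum of all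
  \<open>i + p i\<close>; as \<open>p i\<close> runs through the same indices as \<open>i\<close>,
  this is twice 0 + ... + (n - 1).\<close>

lemma degree_det_le:
  fixes A :: "'a::comm_ring_1 poly Matrix.mat"
  assumes A: "A \<in> carrier_mat n n"
    and deg: "\<And>i j. i < n \<Longrightarrow> j < n \<Longrightarrow> degree (A $$ (i, j)) \<le> i + j"
  shows "degree (Determinant.det A) \<le> n * (n - 1)"
  unfolding det_def'[OF A]
proof (rule degree_sum_le)
  show "finite {p. p permutes {0..<n}}" by (simp add: finite_permutations)
  fix p assume "p \<in> {p. p permutes {0..<n}}"
  then have p: "p permutes {0..<n}" by simp
  have "degree (signof p * (\<Prod>i = 0..<n. A $$ (i, p i))) \<le> degree (\<Prod>i = 0..<n. A $$ (i, p i))"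
    by (simp add: sign_def)
  also have "\<dots> \<le> (\<Sum>i = 0..<n. degree (A $$ (i, p i)))"
    using degree_prod_sum_le[of "{0..<n}"] by (simp add: comp_def)
  also have "\<dots> \<le> (\<Sum>i = 0..<n. i + p i)"
    using p by (intro sum_mono deg) (auto dest: permutes_in_image)
  also have "\<dots> = (\<Sum>i = 0..<n. i) + (\<Sum>i = 0..<n. i)"
    using sum.permute[OF p, of "\<lambda>i. i"] by (simp add: sum.distrib comp_def)
  also have "\<dots> = n * (n - 1)"
  proof (induction n)
    case (Suc n)
    then show ?case by (cases n) simp_all
  qed simp
  finally show "degree (signof p * (\<Prod>i = 0..<n. A $$ (i, p i))) \<le> n * (n - 1)" .
qed

lemma poly_det: "poly (Determinant.det A) y = Determinant.det (map_mat (\<lambda>p. poly p y) A)"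
proof -
  interpret comm_ring_hom "\<lambda>p. poly p y" by standard auto
  show ?thesis by simp
qed

lemma interpolation_poly:
  fixes f :: "'a::{field,finite} \<Rightarrow> 'a"
  shows "\<exists>P. degree P \<le> CARD('a) - 1 \<and> (\<forall>y. poly P y = f y)"
proof -
  \<comment> \<open>Lagrange basis up to scaling: \<open>L z\<close> vanishes everywhere except at
    \<open>z\<close>.\<close>
  define L where "L z = (\<Prod>u\<in>UNIV - {z}. [:- u, 1:])" for z :: 'a
  define P where "P = (\<Sum>z\<in>UNIV. Polynomial.smult (f z / poly (L z) z) (L z))"
  have Lz: "poly (L z) z \<noteq> 0" for z by (auto simp: L_def poly_prod)
  have L0: "poly (L z) y = 0" if "y \<noteq> z" for y z
    using that by (auto simp: L_def poly_prod)
  have "poly P y = (\<Sum>z\<in>UNIV. if z = y then f y else 0)" for y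
    unfolding P_def poly_sum
  proof (rule sum.cong)
    show "poly (Polynomial.smult (f z / poly (L z) z) (L z)) y = (if z = y then f y else 0)" for z
      using Lz[of z] L0[of y z] by (cases "z = y") auto
  qed simp
  then have "poly P y = f y" for y by simp
  moreover have "degree P \<le> CARD('a) - 1"
    unfolding P_def
  proof (rule degree_sum_le)
    fix z :: 'a
    have "degree (L z) = CARD('a) - 1"
      unfolding L_def by (subst degree_prod_eq_sum_degree) (auto simp: card_Diff_singleton)
    then show "degree (Polynomial.smult (f z / poly (L z) z) (L z)) \<le> CARD('a) - 1" by simp
  qed simp
  ultimately show ?thesis by blast
qed

text \<open>For 0 < k < q - 1 the polynomial X^k - 1 has too few roots to kill all nonzero elements,
  so some nonzero \<open>a\<close> has \<open>a ^ k \<noteq> 1\<close>. Substituting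
  \<open>a * x\<close> for \<open>x\<close> multiplies the sum by \<open>a ^ k\<close> without
  changing it. For k = 0 the sum is q times 1, which is 0 in the field.\<close>

lemma sum_powers_finite_field:
  assumes "k < CARD('a::{field,finite}) - 1"
  shows "(\<Sum>x\<in>UNIV. (x::'a) ^ k) = 0"
proof (cases "k = 0")
  case True
  then show ?thesis using CHAR_dvd_CARD[where 'a='a] by (simp add: of_nat_eq_0_iff_char_dvd)
next
  case False
  define R where "R = Polynomial.monom 1 k - (1::'a poly)"
  have "poly.coeff R k = 1" using False by (simp add: R_def coeff_1)
  then have "R \<noteq> 0" by auto
  have "degree R \<le> k"
    unfolding R_def by (intro degree_diff_le degree_monom_le) auto
  then have "card {x. poly R x = 0} < CARD('a) - 1"
    using card_poly_roots_bound[OF \<open>R \<noteq> 0\<close>] assms by simp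
  also have "\<dots> = card (UNIV - {0::'a})" by (simp add: card_Diff_singleton)
  finally have "\<not> UNIV - {0} \<subseteq> {x. poly R x = 0}"
    by (meson card_mono finite leD)
  then obtain a where "a \<noteq> 0" "poly R a \<noteq> 0" by auto
  then have a: "a \<noteq> 0" "a ^ k \<noteq> 1" by (simp_all add: R_def poly_monom)
  have "(\<Sum>x\<in>UNIV. x ^ k) = (\<Sum>x\<in>UNIV. (a * x) ^ k)"
    by (rule sum.reindex_bij_witness[of _ "\<lambda>x. a * x" "\<lambda>x. x / a"]) (use a in auto)
  also have "\<dots> = a ^ k * (\<Sum>x\<in>UNIV. x ^ k)" by (simp add: power_mult_distrib sum_distrib_left)
  finally have "(a ^ k - 1) * (\<Sum>x\<in>UNIV. x ^ k) = 0" by (simp add: algebra_simps)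
  then show ?thesis using a by simp
qed


text \<open>At y the matrix \<open>P (i + j)\<close> is the Gram matrix of the form \<open>(u, v) \<mapsto> \<Sum>x. G x * u x * v x\<close> on
  polynomials of degree less than n.  Multiples of \<open>w = (\<Prod>x\<in>N. X - x)\<close> lie in its radical, so
  in the basis \<open>1, X, ..., X^(t-1), w, X w, ...\<close> the last \<open>n - t\<close> columns are divisible by \<open>X - y\<close>.\<close>

lemma hankel_order:
  fixes G :: "'a::{field,finite} \<Rightarrow> 'a" and P :: "nat \<Rightarrow> 'a poly"
  assumes P: "\<And>k. poly (P k) y = (\<Sum>x\<in>UNIV. x ^ k * G x)"
  shows "[:- y, 1:] ^ (n - card {x. G x \<noteq> 0}) dvd
    Determinant.det (Matrix.mat n n (\<lambda>(i, j). P (i + j)))"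
    (is "_ dvd Determinant.det ?M")
proof -
  define N where "N = {x. G x \<noteq> 0}"
  define t where "t = card N"
  define w where "w = (\<Prod>x\<in>N. [:- x, 1:])"
  define u where "u j = (if j < t then Polynomial.monom 1 j else Polynomial.monom 1 (j - t) * w)" for j
  have w: "degree w = t" "lead_coeff w = 1"
    unfolding w_def t_def
    by (subst degree_prod_eq_sum_degree) (auto simp: lead_coeff_prod)
  then have "w \<noteq> 0" by auto
  have deg_u: "degree (u j) = j" and lc_u: "poly.coeff (u j) j = 1" for j
  proof -
    have "degree (u j) = j \<and> lead_coeff (u j) = 1"
      using w \<open>w \<noteq> 0\<close> by (auto simp: u_def degree_mult_eq degree_monom_eq coeff_monom_mult)
    then show "degree (u j) = j" "poly.coeff (u j) j = 1" by auto
  qed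
  \<comment> \<open>The columns of \<open>U\<close> are the coefficients of the monic polynomials
    \<open>u j\<close> of degree \<open>j\<close>. So \<open>U\<close> is unitriangular, and the
    change of basis on the columns alone preserves the determinant.\<close>
  define U where "U = Matrix.mat n n (\<lambda>(k, j). [:poly.coeff (u j) k:])"
  have U: "U \<in> carrier_mat n n" and M: "?M \<in> carrier_mat n n" by (auto simp: U_def)
  have "upper_triangular U"
    unfolding upper_triangular_def by (auto simp: U_def deg_u coeff_eq_0)
  then have "Determinant.det U = prod_list (diag_mat U)"
    using U by (rule det_upper_triangular)
  also have "\<dots> = 1"
    by (simp add: prod_list_diag_prod U_def lc_u flip: one_pCons)
  finally have detU: "Determinant.det U = 1" .
  define d where "d j = (if j < t then 1 else [:- y, 1:])" for j
  have "(\<Prod>j = 0..<n. d j) dvd Determinant.det (?M * U)"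
  proof (rule det_dvd_prod_columns)
    show "?M * U \<in> carrier_mat n n" using M U by (rule mult_carrier_mat)
    fix i j assume ij: "i < n" "j < n"
    show "d j dvd (?M * U) $$ (i, j)"
    proof (cases "j < t")
      case False
      have "(?M * U) $$ (i, j) = (\<Sum>k = 0..<n. P (i + k) * [:poly.coeff (u j) k:])"
        using ij by (simp add: U_def scalar_prod_def)
      then have "poly ((?M * U) $$ (i, j)) y
          = (\<Sum>k = 0..<n. \<Sum>x\<in>UNIV. x ^ (i + k) * G x * poly.coeff (u j) k)"
        by (simp add: poly_sum P sum_distrib_left mult_ac)
      also have "\<dots> = (\<Sum>x\<in>UNIV. \<Sum>k = 0..<n. x ^ (i + k) * G x * poly.coeff (u j) k)"
        by (rule sum.swap)
      also have "\<dots> = (\<Sum>x\<in>UNIV. x ^ i * G x * (\<Sum>k = 0..<n. poly.coeff (u j) k * x ^ k))"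
        by (simp add: sum_distrib_left power_add algebra_simps)
      also have "\<dots> = (\<Sum>x\<in>UNIV. x ^ i * G x * poly (u j) x)"
      proof -
        have "(\<Sum>k = 0..<n. poly.coeff (u j) k * x ^ k) = poly (u j) x" for x
          unfolding poly_altdef
          by (rule sum.mono_neutral_right) (use ij in \<open>auto simp: deg_u coeff_eq_0\<close>)
        then show ?thesis by simp
      qed
      also have "\<dots> = 0"
      proof (rule sum.neutral, rule ballI)
        fix x
        have "poly w x = 0" if "G x \<noteq> 0" using that by (auto simp: w_def poly_prod N_def)
        then show "x ^ i * G x * poly (u j) x = 0" using False by (auto simp: u_def)
      qed
      finally show ?thesis using False by (simp add: d_def poly_eq_0_iff_dvd)
    qed (simp add: d_def)
  qed
  moreover have "(\<Prod>j = 0..<n. d j) = [:- y, 1:] ^ (n - t)"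
  proof -
    have "(\<Prod>j = 0..<n. d j) = (\<Prod>j = t..<n. [:- y, 1:])"
      by (rule prod.mono_neutral_cong_right) (auto simp: d_def)
    then show ?thesis by simp
  qed
  ultimately show ?thesis
    using det_mult[OF M U] detU by (simp add: t_def N_def)
qed

text \<open>A kernel vector is a polynomial of degree less than n that is orthogonal, with weights
  \<open>G\<close>, to all polynomials of degree less than n. Suitable test polynomials show that it
  vanishes at all n points of the support of \<open>G\<close>, so it is 0.\<close>

lemma hankel_det_nonzero:
  fixes G :: "'a::{field,finite} \<Rightarrow> 'a"
  assumes n: "n = card {x. G x \<noteq> 0}"
  shows "Determinant.det (Matrix.mat n n (\<lambda>(i, j). \<Sum>x\<in>UNIV. x ^ (i + j) * G x)) \<noteq> 0"
    (is "Determinant.det ?M \<noteq> 0")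
proof
  have M: "?M \<in> carrier_mat n n" by simp
  assume "Determinant.det ?M = 0"
  then obtain v where v: "v \<in> carrier_vec n" "v \<noteq> 0\<^sub>v n" "?M *\<^sub>v v = 0\<^sub>v n"
    using det_0_iff_vec_prod_zero_field[OF M] by blast
  define V where "V = (\<Sum>k = 0..<n. Polynomial.monom (vec_index v k) k)"
  have coeff_V: "poly.coeff V k = (if k < n then vec_index v k else 0)" for k
    by (simp add: V_def coeff_sum)
  have poly_V: "poly V x = (\<Sum>k = 0..<n. vec_index v k * x ^ k)" for x
    by (simp add: V_def poly_sum poly_monom)
  have moment: "(\<Sum>x\<in>UNIV. x ^ i * poly V x * G x) = 0" if "i < n" for i
  proof -
    have "(\<Sum>x\<in>UNIV. x ^ i * poly V x * G x)
        = (\<Sum>x\<in>UNIV. \<Sum>k = 0..<n. x ^ (i + k) * G x * vec_index v k)"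
      by (simp add: poly_V sum_distrib_left sum_distrib_right power_add algebra_simps)
    also have "\<dots> = (\<Sum>k = 0..<n. (\<Sum>x\<in>UNIV. x ^ (i + k) * G x) * vec_index v k)"
      by (subst sum.swap) (simp add: sum_distrib_right)
    also have "\<dots> = vec_index (?M *\<^sub>v v) i"
      using that v(1) by (simp add: scalar_prod_def)
    finally show ?thesis using v(3) that by simp
  qed
  have root: "poly V z = 0" if z: "G z \<noteq> 0" for z
  proof -
    \<comment> \<open>This test polynomial of degree n - 1 vanishes on the whole support of
      \<open>G\<close> except at \<open>z\<close>, so orthogonality to it isolates the value of
      \<open>V\<close> at \<open>z\<close>.\<close>
    define u where "u = (\<Prod>x\<in>{x. G x \<noteq> 0} - {z}. [:- x, 1:])"
    have "degree u = card ({x. G x \<noteq> 0} - {z})"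
      unfolding u_def by (subst degree_prod_eq_sum_degree) auto
    also have "\<dots> < n" unfolding n using z by (intro psubset_card_mono) auto
    finally have deg_u: "degree u < n" .
    have "0 = (\<Sum>i\<le>degree u. poly.coeff u i * (\<Sum>x\<in>UNIV. x ^ i * poly V x * G x))"
      using deg_u by (intro sum.neutral[symmetric]) (simp add: moment)
    also have "\<dots> = (\<Sum>x\<in>UNIV. \<Sum>i\<le>degree u. poly.coeff u i * x ^ i * (poly V x * G x))"
      by (subst sum.swap) (simp add: sum_distrib_left algebra_simps)
    also have "\<dots> = (\<Sum>x\<in>UNIV. poly u x * (poly V x * G x))"
      by (simp add: poly_altdef sum_distrib_right)
    also have "\<dots> = (\<Sum>x\<in>{z}. poly u x * (poly V x * G x))"
      by (rule sum.mono_neutral_right) (auto simp: u_def poly_prod)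
    finally have "poly u z * (poly V z * G z) = 0" by simp
    moreover have "poly u z \<noteq> 0" by (auto simp: u_def poly_prod)
    ultimately show ?thesis using z by simp
  qed
  have "V \<noteq> 0"
  proof
    assume "V = 0"
    then have "v = 0\<^sub>v n"
      using v(1) coeff_V by (intro eq_vecI) (metis coeff_0 index_zero_vec carrier_vecD)+
    with v(2) show False by simp
  qed
  have "n > 0" using v by (cases n) (auto intro!: eq_vecI)
  then have "degree V < n" by (intro degree_lessI) (auto simp: coeff_V \<open>V \<noteq> 0\<close>)
  moreover have "n \<le> card {x. poly V x = 0}"
    unfolding n using root by (intro card_mono) auto
  moreover have "card {x. poly V x = 0} \<le> degree V"
    using card_poly_roots_bound[OF \<open>V \<noteq> 0\<close>] .
  ultimately show False by simp
qed

text \<open>Take the Hankel determinant of size \<open>n = s y0\<close> as a polynomial in y. It is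
  nonzero at \<open>y0\<close>, has degree at most n(n - 1), and has a zero of order at least
  \<open>n - s y\<close> at each y. Counting zeros with multiplicity gives the inequality.\<close>

lemma sum_nonzero_counts_ge:
  fixes G :: "'a::{field,finite} \<Rightarrow> 'a \<Rightarrow> 'a"
  assumes moments: "\<And>k. \<exists>P. degree P \<le> k \<and> (\<forall>y. poly P y = (\<Sum>x\<in>UNIV. x ^ k * G x y))"
  defines "s \<equiv> \<lambda>y. card {x. G x y \<noteq> 0}"
  shows "CARD('a) * s y0 \<le> s y0 * (s y0 - 1) + (\<Sum>y\<in>UNIV. s y)"
proof -
  obtain P where deg_P: "\<And>k. degree (P k) \<le> k"
    and poly_P: "\<And>k y. poly (P k) y = (\<Sum>x\<in>UNIV. x ^ k * G x y)"
    using moments by metis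
  define n where "n = s y0"
  define M where "M = Matrix.mat n n (\<lambda>(i, j). P (i + j))"
  define D where "D = Determinant.det M"
  have M: "M \<in> carrier_mat n n" by (simp add: M_def)
  have "map_mat (\<lambda>p. poly p y0) M = Matrix.mat n n (\<lambda>(i, j). \<Sum>x\<in>UNIV. x ^ (i + j) * G x y0)"
    by (rule eq_matI) (auto simp: M_def poly_P)
  then have "poly D y0 \<noteq> 0"
    using hankel_det_nonzero[of n "\<lambda>x. G x y0"] by (simp add: D_def poly_det n_def s_def)
  then have "D \<noteq> 0" by auto
  have order: "n - s y \<le> Polynomial.order y D" for y
  proof -
    have "[:- y, 1:] ^ (n - s y) dvd D"
      using hankel_order[of P y "\<lambda>x. G x y" n] by (simp add: poly_P D_def M_def s_def)
    with \<open>D \<noteq> 0\<close> show ?thesis by (simp add: order_divides)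
  qed
  have "(\<Sum>y\<in>UNIV. n - s y) \<le> (\<Sum>y\<in>UNIV. Polynomial.order y D)"
    by (rule sum_mono) (rule order)
  also have "\<dots> = (\<Sum>y | poly D y = 0. Polynomial.order y D)"
    by (rule sum.mono_neutral_right) (auto simp: order_root)
  also have "\<dots> \<le> degree D" using \<open>D \<noteq> 0\<close> by (rule sum_order_le_degree)
  also have "\<dots> \<le> n * (n - 1)"
    unfolding D_def by (rule degree_det_le[OF M]) (simp add: M_def deg_P)
  finally have "(\<Sum>y\<in>UNIV. n - s y) \<le> n * (n - 1)" .
  \<comment> \<open>With truncated subtraction \<open>n \<le> (n - s y) + s y\<close> also holds at
    those y with \<open>s y > n\<close>.\<close>
  moreover have "CARD('a) * n \<le> (\<Sum>y\<in>UNIV. (n - s y) + s y)"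
    using sum_mono[of UNIV "\<lambda>_. n" "\<lambda>y. (n - s y) + s y"] by simp
  ultimately show ?thesis by (simp add: sum.distrib n_def)
qed

section \<open>Codewords on affine charts of planes\<close>

text \<open>The value at the point spanned by v of the combination of hyperplanes with coefficients \<open>l\<close>.\<close>

definition hval :: "(('a::field ^ 'n) set \<Rightarrow> 'f::field) \<Rightarrow> 'a ^ 'n \<Rightarrow> 'f" where
  "hval l v = (\<Sum>H\<in>pg_hyperplanes. l H * of_bool (v \<in> H))"

lemma subspace_hyperplane: "H \<in> pg_hyperplanes \<Longrightarrow> vec.subspace H"
  by (simp add: pg_hyperplanes_def)

lemma subspace_smult_iff:
  "vec.subspace H \<Longrightarrow> t \<noteq> 0 \<Longrightarrow> t *s v \<in> H \<longleftrightarrow> v \<in> H"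
  for v :: "'a::field ^ 'n"
  using vec.subspace_scale[of H v t] vec.subspace_scale[of H "t *s v" "inverse t"]
  by auto

lemma subspace_add_iff:
  fixes v r :: "'a::field ^ 'n"
  assumes "vec.subspace H" "r \<in> H"
  shows "v + r \<in> H \<longleftrightarrow> v \<in> H"
  using vec.subspace_add[of H v r] vec.subspace_diff[of H "v + r" r] assms by auto

lemma hval_smult:
  assumes "t \<noteq> 0"
  shows "hval l (t *s v) = hval l v"
  unfolding hval_def using assms
  by (intro sum.cong refl) (simp add: subspace_smult_iff subspace_hyperplane)

lemma hyperplane_complement:
  fixes u :: "'a::field ^ 'n"
  assumes H: "H \<in> pg_hyperplanes" and u: "u \<notin> H"
  shows "\<exists>a. v - a *s u \<in> H"
proof -
  have sub: "vec.subspace H" and dim: "vec.dim H = CARD('n) - 1"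
    using H by (auto simp: pg_hyperplanes_def)
  have span: "vec.span H = H" using sub by simp
  have "vec.dim (insert u H) = CARD('n)"
    using u dim by (simp add: vec.dim_insert span)
  then have "vec.span (insert u H) = UNIV"
    using vec.dim_eq_full[of "insert u H"] by (simp add: vec.dimension_def card_cart_basis)
  then have "v \<in> vec.span (insert u H)" by simp
  then show ?thesis by (simp add: vec.span_insert span)
qed

text \<open>If \<open>u \<in> H\<close>, membership does not depend on x, and the power sum over the
  field vanishes. Otherwise each line of direction \<open>u\<close> meets \<open>H\<close> in
  exactly one point, at x = -a - y b, and the moment is the k-th power of this linear polynomial in
  y.\<close>

lemma hyperplane_moments:
  fixes u e w :: "'a::{field,finite} ^ 'n"
  assumes H: "H \<in> pg_hyperplanes" and k: "k < CARD('a) - 1"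
  shows "\<exists>P. degree P \<le> k \<and>
    (\<forall>y. poly P y = (\<Sum>x\<in>UNIV. x ^ k * of_bool (x *s u + e + y *s w \<in> H)))"
proof (cases "u \<in> H")
  case True
  note sub = subspace_hyperplane[OF H]
  have "x *s u + e + y *s w \<in> H \<longleftrightarrow> e + y *s w \<in> H" for x y
    using subspace_add_iff[OF sub vec.subspace_scale[OF sub True, of x], of "e + y *s w"]
    by (simp add: ac_simps)
  then have "(\<Sum>x\<in>UNIV. x ^ k * of_bool (x *s u + e + y *s w \<in> H)) = (0::'a)" for y
    using sum_powers_finite_field[OF k] by (simp flip: sum_distrib_right)
  then show ?thesis by (intro exI[of _ 0]) simp
next
  case False
  note sub = subspace_hyperplane[OF H]
  obtain a b where a: "e - a *s u \<in> H" and b: "w - b *s u \<in> H"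
    using hyperplane_complement[OF H False] by blast
  have iff: "x *s u + e + y *s w \<in> H \<longleftrightarrow> x = - a - y * b" for x y
  proof -
    have "x *s u + e + y *s w
        = (x + a + y * b) *s u + ((e - a *s u) + y *s (w - b *s u))"
      by (simp add: vec.scale_left_distrib vec.scale_right_diff_distrib algebra_simps)
    moreover have R: "(e - a *s u) + y *s (w - b *s u) \<in> H"
      using a b by (intro vec.subspace_add[OF sub] vec.subspace_scale[OF sub])
    ultimately have "x *s u + e + y *s w \<in> H \<longleftrightarrow> (x + a + y * b) *s u \<in> H"
      by (simp only: subspace_add_iff[OF sub R])
    also have "\<dots> \<longleftrightarrow> x + a + y * b = 0"
      using False subspace_smult_iff[OF sub, of "x + a + y * b" u] vec.subspace_0[OF sub]
      by (cases "x + a + y * b = 0") auto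
    also have "\<dots> \<longleftrightarrow> x = - a - y * b" by (auto simp: algebra_simps eq_neg_iff_add_eq_0)
    finally show ?thesis .
  qed
  have "(\<Sum>x\<in>UNIV. x ^ k * of_bool (x *s u + e + y *s w \<in> H)) = poly ([:- a, - b:] ^ k) y" for y
  proof -
    have "(\<Sum>x\<in>UNIV. x ^ k * of_bool (x *s u + e + y *s w \<in> H))
        = (\<Sum>x\<in>UNIV. if x = - a - y * b then (- a - y * b) ^ k else 0)"
      by (rule sum.cong) (auto simp: iff)
    then show ?thesis by simp
  qed
  moreover have "degree ([:- a, - b:] ^ k) \<le> k"
    using degree_power_le[of "[:- a, - b:]" k] by (simp split: if_splits)
  ultimately show ?thesis by (intro exI[of _ "[:- a, - b:] ^ k"]) simp
qed

text \<open>For \<open>k \<ge> q - 1\<close> the degree bound is no restriction, because every function on the field is a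
  polynomial of degree at most \<open>q - 1\<close>.\<close>

lemma codeword_moments:
  fixes u e w :: "'a::{field,finite} ^ 'n" and l :: "('a ^ 'n) set \<Rightarrow> 'a"
  shows "\<exists>P. degree P \<le> k \<and> (\<forall>y. poly P y = (\<Sum>x\<in>UNIV. x ^ k * hval l (x *s u + e + y *s w)))"
proof (cases "k < CARD('a) - 1")
  case True
  have "\<forall>H\<in>pg_hyperplanes. \<exists>P. degree P \<le> k \<and>
      (\<forall>y. poly P y = (\<Sum>x\<in>UNIV. x ^ k * of_bool (x *s u + e + y *s w \<in> H)))"
    by (intro ballI hyperplane_moments True)
  from bchoice[OF this] obtain P where P: "\<forall>H\<in>pg_hyperplanes. degree (P H) \<le> k \<and>
      (\<forall>y. poly (P H) y = (\<Sum>x\<in>UNIV. x ^ k * of_bool (x *s u + e + y *s w \<in> H)))"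
    by blast
  define R where "R = (\<Sum>H\<in>pg_hyperplanes. Polynomial.smult (l H) (P H))"
  have "degree R \<le> k"
    unfolding R_def using P by (intro degree_sum_le) (auto intro: order.trans[OF degree_smult_le])
  moreover have "poly R y = (\<Sum>x\<in>UNIV. x ^ k * hval l (x *s u + e + y *s w))" for y
  proof -
    have "poly R y
        = (\<Sum>H\<in>pg_hyperplanes. \<Sum>x\<in>UNIV. x ^ k * (l H * of_bool (x *s u + e + y *s w \<in> H)))"
      unfolding R_def poly_sum poly_smult
    proof (rule sum.cong)
      fix H :: "('a ^ 'n) set" assume "H \<in> pg_hyperplanes"
      then have "poly (P H) y = (\<Sum>x\<in>UNIV. x ^ k * of_bool (x *s u + e + y *s w \<in> H))"
        using P by blast
      then show "l H * poly (P H) y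
          = (\<Sum>x\<in>UNIV. x ^ k * (l H * of_bool (x *s u + e + y *s w \<in> H)))"
        by (simp only: sum_distrib_left mult.left_commute)
    qed simp
    also have "\<dots> = (\<Sum>x\<in>UNIV. x ^ k * hval l (x *s u + e + y *s w))"
      unfolding hval_def sum_distrib_left by (rule sum.swap)
    finally show ?thesis .
  qed
  ultimately show ?thesis by blast
next
  case False
  then show ?thesis
    using interpolation_poly[of "\<lambda>y. \<Sum>x\<in>UNIV. x ^ k * hval l (x *s u + e + y *s w)"]
    using le_trans[OF _ leI[OF False]] by blast
qed

section \<open>The Szonyi-Weiner inequality for values in the prime field\<close>

text \<open>Codewords take values in a field with p elements, while the moments live in the field
  with q elements. Both have characteristic p, so sending an element to the image of any natural
  number representing it is well defined and injective.\<close>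

lemma prime_field_embedding:
  assumes f: "CARD('f::{field,finite}) = p" and a: "CARD('a::{field,finite}) = p ^ h" and p: "prime p"
  shows "\<exists>\<phi> :: 'f \<Rightarrow> 'a. (\<forall>x y. \<phi> (x + y) = \<phi> x + \<phi> y) \<and> (\<forall>x y. \<phi> (x * y) = \<phi> x * \<phi> y)
    \<and> \<phi> 1 = 1 \<and> (\<forall>x. \<phi> x = 0 \<longleftrightarrow> x = 0)"
proof -
  have char_f: "CHAR('f) = p"
    using CHAR_dvd_CARD[where 'a='f] CHAR_not_1[where 'a='f] f p
    by (auto simp: prime_nat_iff)
  have "prime CHAR('a)"
    by (intro prime_CHAR_semidom finite_imp_CHAR_pos) simp
  moreover have "CHAR('a) dvd p ^ h" using CHAR_dvd_CARD[where 'a='a] a by simp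
  ultimately have char_a: "CHAR('a) = p"
    using p prime_dvd_power primes_dvd_imp_eq by blast
  have "inj_on (of_nat :: nat \<Rightarrow> 'f) {..<p}"
    by (rule inj_onI) (auto simp: of_nat_eq_iff_cong_CHAR char_f cong_def)
  then have "card ((of_nat :: nat \<Rightarrow> 'f) ` {..<p}) = CARD('f)"
    by (simp add: card_image f)
  then have surj: "(of_nat :: nat \<Rightarrow> 'f) ` {..<p} = UNIV"
    by (intro card_subset_eq) auto
  define \<nu> where "\<nu> = inv_into {..<p} (of_nat :: nat \<Rightarrow> 'f)"
  have \<nu>: "of_nat (\<nu> x) = x" for x :: 'f
    unfolding \<nu>_def using surj by (intro f_inv_into_f) auto
  have eq: "of_nat m = (of_nat n :: 'a) \<longleftrightarrow> of_nat m = (of_nat n :: 'f)" for m n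
    by (simp add: of_nat_eq_iff_cong_CHAR char_f char_a)
  show ?thesis
  proof (intro exI[of _ "\<lambda>x. of_nat (\<nu> x)"] conjI allI)
    fix x y :: 'f
    show "of_nat (\<nu> (x + y)) = (of_nat (\<nu> x) + of_nat (\<nu> y) :: 'a)"
      using eq[of "\<nu> (x + y)" "\<nu> x + \<nu> y"] by (simp add: \<nu>)
    show "of_nat (\<nu> (x * y)) = (of_nat (\<nu> x) * of_nat (\<nu> y) :: 'a)"
      using eq[of "\<nu> (x * y)" "\<nu> x * \<nu> y"] by (simp add: \<nu>)
    show "of_nat (\<nu> 1) = (1 :: 'a)" using eq[of "\<nu> 1" 1] by (simp add: \<nu>)
    show "(of_nat (\<nu> x) = (0 :: 'a)) = (x = 0)" using eq[of "\<nu> x" 0] by (simp add: \<nu>)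
  qed
qed

text \<open>The counting inequality for the parallel lines of direction \<open>u\<close> through the
  points \<open>e + y *s w\<close>, taken at the line y = 0. The embedding of the prime field
  preserves which values are nonzero.\<close>

lemma chart_bound:
  fixes u e w :: "'a::{field,finite} ^ 'n" and l :: "('a ^ 'n) set \<Rightarrow> 'f::{field,finite}"
  assumes "CARD('f) = p" "CARD('a) = p ^ h" "prime p"
  defines "s \<equiv> card {x. hval l (x *s u + e) \<noteq> 0}"
  shows "CARD('a) * s \<le> s * (s - 1) + card {(x, y). hval l (x *s u + e + y *s w) \<noteq> 0}"
proof -
  obtain \<phi> :: "'f \<Rightarrow> 'a" where \<phi>: "\<And>x y. \<phi> (x + y) = \<phi> x + \<phi> y" "\<And>x y. \<phi> (x * y) = \<phi> x * \<phi> y"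
    "\<phi> 1 = 1" "\<And>x. \<phi> x = 0 \<longleftrightarrow> x = 0"
    using prime_field_embedding[OF assms(1-3)] by blast
  have \<phi>_sum: "\<phi> (sum f A) = (\<Sum>x\<in>A. \<phi> (f x))" for f and A :: "('a ^ 'n) set set"
    by (induction A rule: infinite_finite_induct) (auto simp: \<phi>)
  have "\<phi> (hval l v) = hval (\<lambda>H. \<phi> (l H)) v" for v
    by (auto simp: hval_def \<phi>_sum \<phi> intro!: sum.cong)
  then have iff: "hval (\<lambda>H. \<phi> (l H)) v \<noteq> 0 \<longleftrightarrow> hval l v \<noteq> 0" for v
    by (metis \<phi>(4))
  have "{(x, y). hval l (x *s u + e + y *s w) \<noteq> 0}
      = (\<lambda>(y, x). (x, y)) ` (SIGMA y:UNIV. {x. hval l (x *s u + e + y *s w) \<noteq> 0})"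
    by (auto simp: image_iff)
  then have "card {(x, y). hval l (x *s u + e + y *s w) \<noteq> 0}
      = card (SIGMA y:(UNIV::'a set). {x. hval l (x *s u + e + y *s w) \<noteq> 0})"
    by (simp add: card_image inj_on_def split_beta prod_eq_iff)
  then show ?thesis
    using sum_nonzero_counts_ge[OF codeword_moments[of _ "\<lambda>H. \<phi> (l H)" u e w], of 0]
    by (simp add: iff s_def)
qed

lemma hval_fun_diff:
  fixes v :: "'a::{field,finite} ^ 'n"
  assumes "J \<subseteq> pg_hyperplanes"
  shows "hval (\<lambda>H. if H \<in> J then l H - r H else l H) v = hval l v - (\<Sum>H\<in>J. r H * of_bool (v \<in> H))"
proof -
  have "(\<Sum>H\<in>J. r H * of_bool (v \<in> H)) = (\<Sum>H\<in>pg_hyperplanes. if H \<in> J then r H * of_bool (v \<in> H) else 0)"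
    using assms by (simp add: sum.If_cases Int_absorb1)
  moreover have "hval (\<lambda>H. if H \<in> J then l H - r H else l H) v + 
      (\<Sum>H\<in>pg_hyperplanes. if H \<in> J then r H * of_bool (v \<in> H) else 0) = hval l v"
    unfolding hval_def sum.distrib[symmetric] by (rule sum.cong) (auto simp: algebra_simps)
  ultimately show ?thesis by (simp add: algebra_simps)
qed

section \<open>Intersections with a hyperplane, and lines with few nonzero values\<close>

lemma card_line_le_1:
  fixes u e :: "'a::{field,finite} ^ 'n"
  assumes "vec.subspace H" "u \<notin> H \<or> e \<notin> H"
  shows "card {x. x *s u + e \<in> H} \<le> 1"
proof -
  have "x = y" if "x *s u + e \<in> H" "y *s u + e \<in> H" for x y
  proof (rule ccontr)
    assume "x \<noteq> y"
    have "(x - y) *s u \<in> H"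
      using vec.subspace_diff[OF assms(1) that] by (simp add: vec.scale_left_diff_distrib)
    then have "u \<in> H"
      by (rule iffD1[OF subspace_smult_iff[OF assms(1)], rotated]) (use \<open>x \<noteq> y\<close> in simp)
    moreover from this have "e \<in> H"
      using subspace_add_iff[OF assms(1) vec.subspace_scale[OF assms(1), of u x], of e] that(1)
      by (simp add: add.commute)
    ultimately show False using assms(2) by blast
  qed
  then show ?thesis by (intro card_le_Suc0_iff_eq[THEN iffD2, unfolded One_nat_def[symmetric]]) auto
qed

text \<open>If \<open>u \<in> H\<close>, then \<open>H\<close> contains at most one of the q lines
  of direction \<open>u\<close> and misses the others; if not, it meets each of them in at most one
  point.\<close>

lemma card_plane_le:
  fixes u e z :: "'a::{field,finite} ^ 'n"
  assumes sub: "vec.subspace H" and nin: "e \<notin> H \<or> z \<notin> H"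
  shows "card {(x, y). x *s u + e + y *s z \<in> H} \<le> CARD('a)"
proof (cases "u \<in> H")
  case True
  have "x *s u + e + y *s z \<in> H \<longleftrightarrow> y *s z + e \<in> H" for x y
    using subspace_add_iff[OF sub vec.subspace_scale[OF sub True, of x], of "y *s z + e"]
    by (simp add: ac_simps)
  then have "{(x, y). x *s u + e + y *s z \<in> H} = UNIV \<times> {y. y *s z + e \<in> H}" by auto
  then have "card {(x, y). x *s u + e + y *s z \<in> H} = CARD('a) * card {y. y *s z + e \<in> H}"
    by (simp only: card_cartesian_product)
  also have "\<dots> \<le> CARD('a) * 1"
    using nin by (intro mult_le_mono le_refl card_line_le_1[OF sub]) auto
  finally show ?thesis by simp
next
  case False
  have "{(x, y). x *s u + e + y *s z \<in> H} = (\<lambda>(y, x). (x, y)) ` (SIGMA y:UNIV. {x. x *s u + (e + y *s z) \<in> H})"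
    by (auto simp: image_iff add.assoc)
  then have "card {(x, y). x *s u + e + y *s z \<in> H} = card (SIGMA y:(UNIV::'a set). {x. x *s u + (e + y *s z) \<in> H})"
    by (simp add: card_image inj_on_def split_beta prod_eq_iff)
  also have "\<dots> = (\<Sum>y\<in>UNIV. card {x. x *s u + (e + y *s z) \<in> H})" by simp
  also have "\<dots> \<le> (\<Sum>y\<in>(UNIV::'a set). 1)"
    using False by (intro sum_mono card_line_le_1[OF sub]) auto
  finally show ?thesis by simp
qed

text \<open>The hypothesis says s(q + 1 - s) \<le> mq. The left side is concave in s and takes the
  value (m + 1)(q - m) = mq + q - m(m + 1) > mq at both s = m + 1 and s = q - m, so it exceeds mq on
  the whole interval between them.\<close>

lemma quadratic_gap:
  fixes q s m :: nat
  assumes "q * s \<le> s * (s - 1) + m * q" "s \<le> q - m" "m * (m + 1) < q" "m \<le> q"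
  shows "s \<le> m"
proof (rule ccontr)
  assume "\<not> s \<le> m"
  define S M Q where S_M_Q_def: "S = int s" "M = int m" "Q = int q"
  have "S \<ge> M + 1" "S + M \<le> Q" "M \<ge> 0"
    using \<open>\<not> s \<le> m\<close> assms by (simp_all add: S_M_Q_def)
  have "int (s * (s - 1)) = S * (S - 1)"
    using \<open>\<not> s \<le> m\<close> by (simp add: S_M_Q_def of_nat_diff)
  then have "Q * S \<le> S * (S - 1) + M * Q"
    using assms(1) unfolding S_M_Q_def by (metis of_nat_add of_nat_le_iff of_nat_mult)
  moreover have "M * (M + 1) < Q"
    using assms(3) unfolding S_M_Q_def by (metis of_nat_1 of_nat_add of_nat_less_iff of_nat_mult)
  moreover have "(S - (M + 1)) * (Q - M - S) \<ge> 0"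
    using \<open>S \<ge> M + 1\<close> \<open>S + M \<le> Q\<close> by simp
  ultimately show False by (simp add: algebra_simps)
qed

text \<open>The nonzero values of the chart lie on at most m hyperplanes, each with at most q points
  of the chart. The chart thus carries at most mq nonzero values, and the quadratic inequality
  leaves a gap between m and q - m.\<close>

lemma line_weight_small:
  fixes u e z :: "'a::{field,finite} ^ 'n" and l :: "('a ^ 'n) set \<Rightarrow> 'f::{field,finite}"
  assumes card: "CARD('f) = p" "CARD('a) = p ^ h" "prime p"
    and J: "J \<subseteq> pg_hyperplanes" "card J \<le> m"
    and zero: "\<And>x y. x *s u + e + y *s z \<notin> \<Union>J \<Longrightarrow> hval l (x *s u + e + y *s z) = 0"
    and nin: "\<And>H. H \<in> J \<Longrightarrow> e \<notin> H \<or> z \<notin> H"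
    and s: "card {x. hval l (x *s u + e) \<noteq> 0} \<le> CARD('a) - m"
    and m: "m * (m + 1) < CARD('a)"
  shows "card {x. hval l (x *s u + e) \<noteq> 0} \<le> m"
proof (rule quadratic_gap[OF _ s m])
  have "{(x, y). hval l (x *s u + e + y *s z) \<noteq> 0} \<subseteq> (\<Union>H\<in>J. {(x, y). x *s u + e + y *s z \<in> H})"
    using zero by fastforce
  then have "card {(x, y). hval l (x *s u + e + y *s z) \<noteq> 0}
      \<le> card (\<Union>H\<in>J. {(x, y). x *s u + e + y *s z \<in> H})"
    by (intro card_mono) auto
  also have "\<dots> \<le> (\<Sum>H\<in>J. card {(x, y). x *s u + e + y *s z \<in> H})"
    by (rule card_UN_le) simp
  also have "\<dots> \<le> (\<Sum>H\<in>J. CARD('a))"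
    using J nin by (intro sum_mono card_plane_le) (auto dest: subspace_hyperplane)
  also have "\<dots> \<le> m * CARD('a)" using J by simp
  finally show "CARD('a) * card {x. hval l (x *s u + e) \<noteq> 0} \<le> card {x. hval l (x *s u + e) \<noteq> 0} *
      (card {x. hval l (x *s u + e) \<noteq> 0} - 1) + m * CARD('a)"
    using chart_bound[OF card, of l u e z] by linarith
  have "m * 1 \<le> m * (m + 1)" by (intro mult_le_mono) auto
  then show "m \<le> CARD('a)" using m by linarith
qed

section \<open>Coordinates on a plane\<close>

text \<open>Extend \<open>z\<close>, \<open>e\<close> to a basis of the plane. At most one vector
  \<open>t\<close> is added, and shifting it by a multiple of \<open>z\<close> moves it into
  \<open>H\<close> without changing the span.\<close>

lemma plane_chart:
  fixes e z :: "'a::field ^ 'n"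
  assumes H: "H \<in> pg_hyperplanes" and e: "e \<in> H" "e \<noteq> 0" and z: "z \<notin> H"
    and S: "finite S" "card S \<le> 3" "e \<in> vec.span S" "z \<in> vec.span S"
  shows "\<exists>u. u \<in> H \<and> u \<in> vec.span S \<and> (\<forall>v\<in>vec.span S. \<exists>a b c. v = a *s u + b *s e + c *s z)"
proof -
  note sub = subspace_hyperplane[OF H]
  have "z \<notin> vec.span {e}"
  proof
    assume "z \<in> vec.span {e}"
    also have "vec.span {e} \<subseteq> H" using e sub by (intro vec.span_minimal) auto
    finally show False using z by simp
  qed
  then have ind: "vec.independent {z, e}"
    using e by (intro vec.independent_insertI) (auto simp: vec.independent_empty)
  obtain B where B: "{z, e} \<subseteq> B" "B \<subseteq> vec.span S" "vec.independent B" "vec.span S \<subseteq> vec.span B"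
    using vec.maximal_independent_subset_extend[of "{z, e}" "vec.span S"] ind S by auto
  have "finite B" "card B \<le> card S"
    using vec.independent_span_bound[OF S(1) B(3) B(2)] by auto
  moreover have "z \<noteq> e" using e z by auto
  ultimately have "card (B - {z, e}) \<le> 1"
    using B(1) S(2) by (subst card_Diff_subset) auto
  \<comment> \<open>If nothing is added, \<open>e\<close> serves as \<open>t\<close>.\<close>
  then obtain t where t: "B - {z, e} \<subseteq> {t}" "t \<in> vec.span S"
    using \<open>finite B\<close> B(2) by (cases "B - {z, e} = {}")
      (auto simp: card_le_Suc0_iff_eq intro: that[OF _ S(3)])
  obtain a where a: "t - a *s z \<in> H" using hyperplane_complement[OF H z] by blast
  show ?thesis
  proof (intro exI[of _ "t - a *s z"] conjI ballI)
    show "t - a *s z \<in> H" by (rule a)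
    show "t - a *s z \<in> vec.span S"
      using t S by (intro vec.span_diff vec.span_scale)
    fix v assume "v \<in> vec.span S"
    also have "vec.span S \<subseteq> vec.span {t, e, z}"
      using B(4) t(1) vec.span_mono[of B "{t, e, z}"] by blast
    finally obtain c1 c2 c3 where "v - c1 *s t - c2 *s e - c3 *s z = 0"
      by (auto simp: vec.span_insert)
    then have "v = c1 *s (t - a *s z) + c2 *s e + (c1 * a + c3) *s z"
      by (simp add: vec.scale_right_diff_distrib vec.scale_left_distrib algebra_simps)
    then show "\<exists>a' b c. v = a' *s (t - a *s z) + b *s e + c *s z" by blast
  qed
qed

lemma independent_coordinates:
  fixes P Q w :: "'a::field ^ 'n"
  assumes sub: "vec.subspace H" and PQ: "P \<in> H" "Q \<in> H" "P \<noteq> 0" "\<And>t. Q \<noteq> t *s P" and w: "w \<notin> H"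
    and eq: "a *s P + b *s Q + c *s w = a' *s P + b' *s Q + c' *s w"
  shows "a = a' \<and> b = b' \<and> c = c'"
proof -
  have "c = c'"
  proof (rule ccontr)
    assume "c \<noteq> c'"
    have "(c - c') *s w = (a' - a) *s P + (b' - b) *s Q"
      using eq by (simp add: vec.scale_left_diff_distrib algebra_simps)
    also have "\<dots> \<in> H" using PQ by (intro vec.subspace_add[OF sub] vec.subspace_scale[OF sub])
    finally have "w \<in> H"
      by (rule iffD1[OF subspace_smult_iff[OF sub], rotated]) (use \<open>c \<noteq> c'\<close> in simp)
    then show False using w by simp
  qed
  have eq': "(b - b') *s Q = (a' - a) *s P"
    using eq \<open>c = c'\<close> by (simp add: vec.scale_left_diff_distrib algebra_simps)
  have "b = b'"
  proof (rule ccontr)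
    assume "b \<noteq> b'"
    then have "Q = inverse (b - b') *s ((b - b') *s Q)" unfolding vec.scale_scale by simp
    also have "\<dots> = (inverse (b - b') * (a' - a)) *s P" unfolding eq' vec.scale_scale ..
    finally show False using PQ(4) by blast
  qed
  then show ?thesis using eq' \<open>c = c'\<close> PQ(3) by simp
qed

text \<open>Different chart parameters give different projective points: the coordinates of a chart
  vector at \<open>P\<close> and \<open>Q\<close> add up to 1, which forces equal scalars.\<close>

lemma chart_proportional:
  fixes P Q w :: "'a::field ^ 'n"
  assumes sub: "vec.subspace H" and PQ: "P \<in> H" "Q \<in> H" "P \<noteq> 0" "\<And>t. Q \<noteq> t *s P" and w: "w \<notin> H"
    and t: "x *s (Q - P) + P + y *s w = t *s v" "x' *s (Q - P) + P + y' *s w = t' *s v"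
  shows "x = x' \<and> y = y'"
proof -
  note coord = independent_coordinates[OF sub PQ w]
  have pt: "x *s (Q - P) + P + y *s w = (1 - x) *s P + x *s Q + y *s w" for x y
    by (simp add: vec.scale_right_diff_distrib vec.scale_left_diff_distrib)
  have "x *s (Q - P) + P + y *s w \<noteq> 0" for x y
  proof
    assume "x *s (Q - P) + P + y *s w = 0"
    then have "(1 - x) *s P + x *s Q + y *s w = 0 *s P + 0 *s Q + 0 *s w"
      by (simp only: pt vec.scale_zero_left add_0_right)
    from coord[OF this] show False by auto
  qed
  then have nz: "t \<noteq> 0" using t by (metis vec.scale_zero_left)
  have "t' *s (x *s (Q - P) + P + y *s w) = t *s (x' *s (Q - P) + P + y' *s w)"
    using t by (simp add: mult.commute)
  then have "(t' * (1 - x)) *s P + (t' * x) *s Q + (t' * y) *s w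
      = (t * (1 - x')) *s P + (t * x') *s Q + (t * y') *s w"
    unfolding pt vec.scale_right_distrib vec.scale_scale .
  from coord[OF this] have *: "t' * (1 - x) = t * (1 - x')" "t' * x = t * x'" "t' * y = t * y'"
    by auto
  then have "t' = t" by (simp add: right_diff_distrib)
  with * nz show ?thesis by simp
qed

lemma majority_value:
  fixes g :: "'a::finite \<Rightarrow> 'f::finite"
  assumes "CARD('f) * (m - 1) < CARD('a)"
  shows "\<exists>r. m \<le> card {x. g x = r}"
proof (rule ccontr)
  assume "\<not> ?thesis"
  then have less: "card {x. g x = r} \<le> m - 1" for r
    by (metis Suc_pred' gr0I le_zero_eq less_Suc_eq_le linorder_not_less nat_le_linear)
  have "UNIV = (\<Union>r. {x. g x = r})" by auto
  then have "CARD('a) = card (\<Union>r. {x. g x = r})" by simp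
  also have "\<dots> \<le> (\<Sum>r\<in>UNIV. card {x. g x = r})" by (rule card_UN_le) simp
  also have "\<dots> \<le> (\<Sum>r\<in>(UNIV::'f set). m - 1)" by (rule sum_mono) (rule less)
  finally show False using assms by simp
qed

text \<open>For 1 \<le> s \<le> q, (s - 1)(q - s) \<ge> 0 gives s(q + 1 - s) \<ge> q > t.\<close>

lemma weight_gap:
  fixes q s t :: nat
  assumes "q * s \<le> s * (s - 1) + t" "t < q" "s \<le> q"
  shows "s = 0"
proof (rule ccontr)
  assume "s \<noteq> 0"
  define S Q where SQ: "S = int s" "Q = int q"
  have "int (s * (s - 1)) = S * (S - 1)" using \<open>s \<noteq> 0\<close> by (simp add: SQ of_nat_diff)
  then have "Q * S \<le> S * (S - 1) + int t"
    using assms(1) unfolding SQ by (metis of_nat_add of_nat_le_iff of_nat_mult)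
  moreover have "(S - 1) * (Q - S) \<ge> 0" using \<open>s \<noteq> 0\<close> assms(3) by (simp add: SQ)
  moreover have "int t < Q" using assms(2) by (simp add: SQ)
  ultimately show False by (simp add: algebra_simps)
qed

text \<open>By pigeonhole over the p values, some \<open>r\<close> is taken at least m times.
  Subtracting \<open>r\<close> times \<open>H\<close> leaves a codeword still vanishing off
  \<open>J\<close> with at most q - m nonzero values on the line, hence with at most m.\<close>

lemma line_almost_constant:
  fixes u e z :: "'a::{field,finite} ^ 'n" and l :: "('a ^ 'n) set \<Rightarrow> 'f::{field,finite}"
  assumes card: "CARD('f) = p" "CARD('a) = p ^ h" "prime p"
    and m: "m * (m + 1) < CARD('a)" "p * (m - 1) < CARD('a)"
    and J: "J \<subseteq> pg_hyperplanes" "card J \<le> m"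
    and zero: "\<And>x y. x *s u + e + y *s z \<notin> \<Union>J \<Longrightarrow> hval l (x *s u + e + y *s z) = 0"
    and H: "H \<in> J" "u \<in> H" "e \<in> H" "e \<notin> \<Union>(J - {H})" "z \<notin> H"
  shows "\<exists>r. card {x. hval l (x *s u + e) \<noteq> r} \<le> m"
proof -
  obtain r where r: "m \<le> card {x. hval l (x *s u + e) = r}"
    using majority_value[of m "\<lambda>x. hval l (x *s u + e)"] m(2) card(1) by auto
  define l' where "l' = (\<lambda>K. if K \<in> {H} then l K - r else l K)"
  have HJ: "H \<in> pg_hyperplanes" using H(1) J(1) by blast
  have l': "hval l' v = hval l v - r * of_bool (v \<in> H)" for v
    using hval_fun_diff[of "{H}" l "\<lambda>_. r" v] HJ by (simp add: l'_def)
  have line: "x *s u + e \<in> H" for x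
    using H HJ by (intro vec.subspace_add vec.subspace_scale) (auto dest: subspace_hyperplane)
  have iff: "hval l' (x *s u + e) \<noteq> 0 \<longleftrightarrow> hval l (x *s u + e) \<noteq> r" for x
    using line[of x] by (simp add: l')
  have "card {x. hval l' (x *s u + e) \<noteq> 0} \<le> m"
  proof (rule line_weight_small[OF card J _ _ _ m(1)])
    show "hval l' (x *s u + e + y *s z) = 0" if "x *s u + e + y *s z \<notin> \<Union>J" for x y
      using zero[OF that] that H(1) by (auto simp: l')
    show "e \<notin> K \<or> z \<notin> K" if "K \<in> J" for K
      using that H by auto
    have "{x. hval l (x *s u + e) \<noteq> r} = UNIV - {x. hval l (x *s u + e) = r}" by auto
    then have "card {x. hval l (x *s u + e) \<noteq> r} = CARD('a) - card {x. hval l (x *s u + e) = r}"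
      by (simp add: card_Diff_subset)
    then show "card {x. hval l' (x *s u + e) \<noteq> 0} \<le> CARD('a) - m"
      using r by (simp add: iff)
  qed
  then show ?thesis by (auto simp: iff)
qed

text \<open>In the plane \<open>\<pi>\<close> through P and Q, choose J minimal among the subfamilies covering the nonzero
  values on \<open>\<pi>\<close>, so that each \<open>H \<in> J\<close> has a point \<open>e H\<close> of its own.  Subtracting the majority values
  \<open>r H\<close> leaves at most \<open>m + 1\<close> nonzero values on each line \<open>H \<inter> \<pi>\<close>: m on its affine part, and one at
  the remaining point \<open>u H\<close>.\<close>

lemma equal_on_simple_points:
  fixes P Q :: "'a::{field,finite} ^ 'n" and l :: "('a ^ 'n) set \<Rightarrow> 'f::{field,finite}"
  assumes card: "CARD('f) = p" "CARD('a) = p ^ h" "prime p"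
    and m: "m * (m + 1) < CARD('a)" "p * (m - 1) < CARD('a)" "3 * m \<le> CARD('a) + 1"
    and \<H>: "\<H> \<subseteq> pg_hyperplanes" "card \<H> \<le> m"
    and zero: "\<And>v. v \<noteq> 0 \<Longrightarrow> v \<notin> \<Union>\<H> \<Longrightarrow> hval l v = 0"
    and H\<^sub>1: "H\<^sub>1 \<in> \<H>"
    and P: "P \<in> H\<^sub>1" "P \<noteq> 0" "P \<notin> \<Union>(\<H> - {H\<^sub>1})"
    and Q: "Q \<in> H\<^sub>1" "Q \<noteq> 0" "Q \<notin> \<Union>(\<H> - {H\<^sub>1})"
  shows "hval l P = hval l Q"
proof (cases "\<exists>t. Q = t *s P")
  case True
  then obtain t where "Q = t *s P" by blast
  then show ?thesis using Q(2) hval_smult[of t l P] by auto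
next
  case False
  have H\<^sub>1_hyp: "H\<^sub>1 \<in> pg_hyperplanes" using H\<^sub>1 \<H> by blast
  note sub\<^sub>1 = subspace_hyperplane[OF H\<^sub>1_hyp]
  have "H\<^sub>1 \<noteq> UNIV"
  proof
    assume "H\<^sub>1 = UNIV"
    then have "CARD('n) = CARD('n) - 1"
      using H\<^sub>1_hyp by (simp add: pg_hyperplanes_def vec.dim_UNIV card_cart_basis vec.dimension_def)
    moreover have "CARD('n) > 0" by simp
    ultimately show False by linarith
  qed
  then obtain w where w: "w \<notin> H\<^sub>1" by blast
  define \<pi> where "\<pi> = vec.span {P, Q, w}"
  have sub_\<pi>: "vec.subspace \<pi>" by (simp add: \<pi>_def)
  have in_\<pi>: "P \<in> \<pi>" "Q \<in> \<pi>" "w \<in> \<pi>" by (auto simp: \<pi>_def vec.span_base)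
  define good where "good J \<longleftrightarrow> J \<subseteq> \<H> \<and> (\<forall>v\<in>\<pi>. v \<noteq> 0 \<longrightarrow> v \<notin> \<Union>J \<longrightarrow> hval l v = 0)" for J
  have "good \<H>" using zero by (auto simp: good_def)
  then obtain J where J: "good J" and J_min: "\<And>K. good K \<Longrightarrow> card J \<le> card K"
    using ex_has_least_nat[of good \<H> card] by blast
  have J_sub: "J \<subseteq> pg_hyperplanes" and J_card: "card J \<le> m"
    using J \<H> card_mono[of \<H> J] by (auto simp: good_def)
  have "\<exists>e. e \<in> \<pi> \<and> e \<noteq> 0 \<and> e \<notin> \<Union>(J - {H}) \<and> hval l e \<noteq> 0" if "H \<in> J" for H
  proof (rule ccontr)
    assume "\<not> ?thesis"
    then have "good (J - {H})" using J by (auto simp: good_def)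
    from J_min[OF this] show False using that card_Diff1_less[of J H] by simp
  qed
  then obtain e where e: "\<And>H. H \<in> J \<Longrightarrow>
      e H \<in> \<pi> \<and> e H \<noteq> 0 \<and> e H \<notin> \<Union>(J - {H}) \<and> hval l (e H) \<noteq> 0"
    by metis
  have e_in: "e H \<in> H" if "H \<in> J" for H
    using e[OF that] J unfolding good_def by auto
  \<comment> \<open>A vector of the plane off \<open>H\<close>: \<open>w\<close> avoids
    \<open>H\<^sub>1\<close>, and \<open>P\<close> avoids every other member.\<close>
  define z where "z H = (if H = H\<^sub>1 then w else P)" for H
  have z: "z H \<notin> H" "z H \<in> \<pi>" if "H \<in> J" for H
    using w P in_\<pi> that J by (auto simp: z_def good_def)
  have "\<exists>u. u \<in> H \<and> u \<in> \<pi> \<and> (\<forall>v\<in>\<pi>. \<exists>a b c. v = a *s u + b *s e H + c *s z H)" if "H \<in> J" for H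
    unfolding \<pi>_def using that e[OF that] e_in[OF that] z[OF that] J_sub
    by (intro plane_chart) (auto simp: \<pi>_def card_insert_if)
  then obtain u where u: "\<And>H. H \<in> J \<Longrightarrow>
      u H \<in> H \<and> u H \<in> \<pi> \<and> (\<forall>v\<in>\<pi>. \<exists>a b c. v = a *s u H + b *s e H + c *s z H)"
    by metis
  have chart: "x *s u H + e H + y *s z H \<in> \<pi>" if "H \<in> J" for H x y
    using u[OF that] e[OF that] z[OF that] sub_\<pi>
    by (intro vec.subspace_add vec.subspace_scale) auto
  have zero_\<pi>: "hval l v = 0" if "v \<in> \<pi>" "v \<notin> \<Union>J" "H \<in> J" for v H
  proof -
    \<comment> \<open>Since \<open>J\<close> has a member, a vector outside \<open>\<Union>J\<close>
      is nonzero, as the definition of \<open>good\<close> demands.\<close>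
    have "0 \<in> H" using that J_sub by (auto intro: vec.subspace_0 dest: subspace_hyperplane)
    then show ?thesis using that J by (auto simp: good_def)
  qed
  have "\<exists>r. card {x. hval l (x *s u H + e H) \<noteq> r} \<le> m" if "H \<in> J" for H
    using that u[OF that] e[OF that] z[OF that] e_in[OF that] chart[OF that] zero_\<pi>[OF _ _ that]
    by (intro line_almost_constant[OF card m(1,2) J_sub J_card]) auto
  then obtain r where r: "\<And>H. H \<in> J \<Longrightarrow> card {x. hval l (x *s u H + e H) \<noteq> r H} \<le> m"
    by metis
  define d where "d = (\<lambda>H. if H \<in> J then l H - r H else l H)"
  have d: "hval d v = hval l v - (\<Sum>H\<in>J. r H * of_bool (v \<in> H))" for v
    unfolding d_def by (rule hval_fun_diff[OF J_sub])
  have d_zero: "hval d v = 0" if "v \<in> \<pi>" "v \<notin> \<Union>J" "H \<in> J" for v H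
    unfolding d using zero_\<pi>[OF that] that by (auto intro: sum.neutral)
  have d_line: "card {x. hval d (x *s u H + e H) \<noteq> 0} \<le> m" if HJ: "H \<in> J" for H
  proof (rule line_weight_small[OF card J_sub J_card _ _ _ m(1)])
    show "hval d (x *s u H + e H + y *s z H) = 0" if "x *s u H + e H + y *s z H \<notin> \<Union>J" for x y
      using d_zero[OF chart[OF HJ] that HJ] .
    show "e H \<notin> K \<or> z H \<notin> K" if "K \<in> J" for K
      using that e[OF HJ] z[OF HJ] by auto
    have sub: "vec.subspace K" if "K \<in> J" for K using that J_sub subspace_hyperplane by blast
    have on_H: "x *s u H + e H \<in> H" for x
      using u[OF HJ] e_in[OF HJ] sub[OF HJ] by (intro vec.subspace_add vec.subspace_scale) auto
    \<comment> \<open>A crude bound comes first: m exceptional parameters, and at most one for each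
      other member of \<open>J\<close>. That is at most 2m - 1 \<le> q - m, and the gap then brings
      it down to m.\<close>
    have "{x. hval d (x *s u H + e H) \<noteq> 0} \<subseteq> {x. hval l (x *s u H + e H) \<noteq> r H}
        \<union> (\<Union>K\<in>J - {H}. {x. x *s u H + e H \<in> K})"
    proof (intro subsetI, rule ccontr)
      fix x assume x: "x \<in> {x. hval d (x *s u H + e H) \<noteq> 0}"
        "x \<notin> {x. hval l (x *s u H + e H) \<noteq> r H} \<union> (\<Union>K\<in>J - {H}. {x. x *s u H + e H \<in> K})"
      have "(\<Sum>K\<in>J. r K * of_bool (x *s u H + e H \<in> K)) = (\<Sum>K\<in>{H}. r K * of_bool (x *s u H + e H \<in> K))"
        using x(2) HJ by (intro sum.mono_neutral_right) auto
      then show False using x on_H[of x] by (simp add: d)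
    qed
    then have "card {x. hval d (x *s u H + e H) \<noteq> 0} \<le> card ({x. hval l (x *s u H + e H) \<noteq> r H}
        \<union> (\<Union>K\<in>J - {H}. {x. x *s u H + e H \<in> K}))"
      by (intro card_mono) auto
    also have "\<dots> \<le> card {x. hval l (x *s u H + e H) \<noteq> r H}
        + card (\<Union>K\<in>J - {H}. {x. x *s u H + e H \<in> K})"
      by (rule card_Un_le)
    also have "\<dots> \<le> m + (\<Sum>K\<in>J - {H}. card {x. x *s u H + e H \<in> K})"
      by (intro add_mono r HJ card_UN_le) simp
    also have "(\<Sum>K\<in>J - {H}. card {x. x *s u H + e H \<in> K}) \<le> (\<Sum>K\<in>J - {H}. 1)"
      using e[OF HJ] sub by (intro sum_mono card_line_le_1) auto
    also have "\<dots> = card J - 1" using HJ by (simp add: card_Diff_singleton)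
    finally show "card {x. hval d (x *s u H + e H) \<noteq> 0} \<le> CARD('a) - m"
      using J_card m(3) card_gt_0_iff[of J] HJ by auto
  qed
  \<comment> \<open>This chart of the plane puts \<open>P\<close> at (0, 0) and \<open>Q\<close> at
    (1, 0), so both lie on the line y = 0.\<close>
  define pt where "pt x y = x *s (Q - P) + P + y *s w" for x y
  define T where "T = {(x, y). hval d (pt x y) \<noteq> 0}"
  have pt_\<pi>: "pt x y \<in> \<pi>" for x y
    unfolding pt_def using in_\<pi> sub_\<pi>
    by (intro vec.subspace_add vec.subspace_scale vec.subspace_diff) auto
  have pt_unique: "card {(x, y). \<exists>t. pt x y = t *s v} \<le> 1" for v
  proof -
    have "x = x' \<and> y = y'" if "pt x y = t *s v" "pt x' y' = t' *s v" for x y x' y' t t'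
      using that False unfolding pt_def
      by (intro chart_proportional[OF sub\<^sub>1 P(1) Q(1) P(2) _ w]) auto
    then show ?thesis
      by (intro card_le_Suc0_iff_eq[THEN iffD2, unfolded One_nat_def[symmetric]]) auto
  qed
  have pt_H: "card {(x, y). hval d (pt x y) \<noteq> 0 \<and> pt x y \<in> H} \<le> m + 1" if HJ: "H \<in> J" for H
  proof -
    have sub: "vec.subspace H" using HJ J_sub subspace_hyperplane by blast
    let ?E = "{x. hval d (x *s u H + e H) \<noteq> 0}"
    have "{(x, y). hval d (pt x y) \<noteq> 0 \<and> pt x y \<in> H}
        \<subseteq> {(x, y). \<exists>t. pt x y = t *s u H} \<union> (\<Union>k\<in>?E. {(x, y). \<exists>t. pt x y = t *s (k *s u H + e H)})"
    proof (rule subrelI, rule ccontr)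
      fix x y
      assume "(x, y) \<in> {(x, y). hval d (pt x y) \<noteq> 0 \<and> pt x y \<in> H}"
        and nin: "(x, y) \<notin> {(x, y). \<exists>t. pt x y = t *s u H}
          \<union> (\<Union>k\<in>?E. {(x, y). \<exists>t. pt x y = t *s (k *s u H + e H)})"
      then have xy: "hval d (pt x y) \<noteq> 0" "pt x y \<in> H" "\<And>t. pt x y \<noteq> t *s u H" by auto
      obtain a b c where abc: "pt x y = a *s u H + b *s e H + c *s z H"
        using u[OF HJ] pt_\<pi> by blast
      have "c *s z H = pt x y - (a *s u H + b *s e H)" by (simp add: abc)
      also have "\<dots> \<in> H" using xy u[OF HJ] e_in[OF HJ]
        by (intro vec.subspace_diff[OF sub] vec.subspace_add[OF sub] vec.subspace_scale[OF sub]) auto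
      finally have "c = 0" using z(1)[OF HJ] subspace_smult_iff[OF sub, of c "z H"] by auto
      have "b \<noteq> 0" using abc \<open>c = 0\<close> xy(3)[of a] by auto
      then have eq: "pt x y = b *s ((a / b) *s u H + e H)"
        by (simp add: abc \<open>c = 0\<close> vec.scale_right_distrib)
      then have "hval d ((a / b) *s u H + e H) \<noteq> 0"
        using xy(1) hval_smult[OF \<open>b \<noteq> 0\<close>] by metis
      then show False using nin eq by blast
    qed
    then have "card {(x, y). hval d (pt x y) \<noteq> 0 \<and> pt x y \<in> H}
        \<le> card ({(x, y). \<exists>t. pt x y = t *s u H} \<union> (\<Union>k\<in>?E. {(x, y). \<exists>t. pt x y = t *s (k *s u H + e H)}))"
      by (intro card_mono) auto
    also have "\<dots> \<le> card {(x, y). \<exists>t. pt x y = t *s u H}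
        + card (\<Union>k\<in>?E. {(x, y). \<exists>t. pt x y = t *s (k *s u H + e H)})"
      by (rule card_Un_le)
    also have "\<dots> \<le> 1 + (\<Sum>k\<in>?E. card {(x, y). \<exists>t. pt x y = t *s (k *s u H + e H)})"
      by (intro add_mono pt_unique card_UN_le) simp
    also have "\<dots> \<le> 1 + (\<Sum>k\<in>?E. 1)"
      by (intro add_left_mono sum_mono pt_unique)
    also have "\<dots> \<le> m + 1" using d_line[OF HJ] by simp
    finally show ?thesis .
  qed
  have "J \<noteq> {} \<Longrightarrow> T \<subseteq> (\<Union>H\<in>J. {(x, y). hval d (pt x y) \<noteq> 0 \<and> pt x y \<in> H})"
    unfolding T_def using d_zero[OF pt_\<pi>] by fastforce
  moreover have "T = {}" if "J = {}"
  proof -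
    have "pt x y \<noteq> 0" for x y
    proof
      assume "pt x y = 0"
      \<comment> \<open>A zero vector would be a multiple of both \<open>P\<close> and
        \<open>Q\<close>, so (x, y) would be (0, 0) and (1, 0) at once.\<close>
      then have "pt x y = 0 *s P" "pt 0 0 = 1 *s P" "pt x y = 0 *s Q" "pt 1 0 = 1 *s Q"
        by (auto simp: pt_def)
      then show False
        using chart_proportional[OF sub\<^sub>1 P(1) Q(1) P(2) _ w, of x y 0 P 0 0 1]
          chart_proportional[OF sub\<^sub>1 P(1) Q(1) P(2) _ w, of x y 0 Q 1 0 1] False
        by (auto simp: pt_def)
    qed
    then show ?thesis using J pt_\<pi> that by (auto simp: T_def d good_def)
  qed
  ultimately have "T \<subseteq> (\<Union>H\<in>J. {(x, y). hval d (pt x y) \<noteq> 0 \<and> pt x y \<in> H})" by blast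
  then have "card T \<le> card (\<Union>H\<in>J. {(x, y). hval d (pt x y) \<noteq> 0 \<and> pt x y \<in> H})"
    by (intro card_mono) auto
  also have "\<dots> \<le> (\<Sum>H\<in>J. card {(x, y). hval d (pt x y) \<noteq> 0 \<and> pt x y \<in> H})"
    by (rule card_UN_le) simp
  also have "\<dots> \<le> (\<Sum>H\<in>J. m + 1)" by (intro sum_mono pt_H)
  also have "\<dots> \<le> m * (m + 1)" using mult_le_mono1[OF J_card, of "m + 1"] by simp
  finally have T: "card T < CARD('a)" using m(1) by linarith
  \<comment> \<open>With fewer than q nonzero values in the chart, the inequality admits none on the
    line y = 0, so \<open>d\<close> vanishes at \<open>P\<close> and \<open>Q\<close>.\<close>
  define s where "s = card {x. hval d (x *s (Q - P) + P) \<noteq> 0}"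
  have "CARD('a) * s \<le> s * (s - 1) + card T"
    using chart_bound[OF card, of d "Q - P" P w] by (simp add: s_def T_def pt_def)
  moreover have "s \<le> CARD('a)" unfolding s_def by (rule card_mono) auto
  ultimately have "s = 0" using T weight_gap by blast
  then have d0: "hval d (x *s (Q - P) + P) = 0" for x by (simp add: s_def)
  \<comment> \<open>At \<open>P\<close> and \<open>Q\<close> alike the subtracted sum is
    \<open>r H\<^sub>1\<close> if \<open>H\<^sub>1 \<in> J\<close>, and 0 otherwise.\<close>
  have sum: "(\<Sum>H\<in>J. r H * of_bool (v \<in> H)) = (\<Sum>H\<in>J \<inter> {H\<^sub>1}. r H)"
    if "v \<in> H\<^sub>1" "v \<notin> \<Union>(\<H> - {H\<^sub>1})" for v
    using that J by (intro sum.mono_neutral_cong_right) (auto simp: good_def)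
  show ?thesis
    using d0[of 0] d0[of 1] sum[OF P(1,3)] sum[OF Q(1,3)] by (simp add: d)
qed

section \<open>Codewords supported on few hyperplanes\<close>

text \<open>Induction on the family, with m fixed. If a nonzero value occurs at a point lying only
  on \<open>H\<close>, it is the common value at all such points, and subtracting it times
  \<open>H\<close> leaves a codeword vanishing off \<open>\<F>\<close>. If none occurs,
  \<open>H\<close> gets coefficient 0.\<close>

lemma codeword_supported_on_hyperplanes:
  fixes l :: "('a::{field,finite} ^ 'n) set \<Rightarrow> 'f::{field,finite}"
  assumes card: "CARD('f) = p" "CARD('a) = p ^ h" "prime p"
    and m: "m * (m + 1) < CARD('a)" "p * (m - 1) < CARD('a)" "3 * m \<le> CARD('a) + 1"
    and \<H>: "\<H> \<subseteq> pg_hyperplanes" "card \<H> \<le> m"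
    and zero: "\<And>v. v \<noteq> 0 \<Longrightarrow> v \<notin> \<Union>\<H> \<Longrightarrow> hval l v = 0"
  shows "\<exists>b. \<forall>v. v \<noteq> 0 \<longrightarrow> hval l v = (\<Sum>H\<in>\<H>. b H * of_bool (v \<in> H))"
proof -
  have "finite \<H>" by simp
  then show ?thesis using \<H> zero
  proof (induction \<H> arbitrary: l rule: finite_induct)
    case empty
    then show ?case by simp
  next
    case (insert H \<F>)
    have H: "H \<in> pg_hyperplanes" and \<F>: "\<F> \<subseteq> pg_hyperplanes" "card \<F> \<le> m"
      using insert by auto
    show ?case
    proof (cases "\<exists>e\<in>H. e \<noteq> 0 \<and> e \<notin> \<Union>\<F> \<and> hval l e \<noteq> 0")
      case True
      then obtain e where e: "e \<in> H" "e \<noteq> 0" "e \<notin> \<Union>\<F>" by blast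
      define l' where "l' = (\<lambda>K. if K \<in> {H} then l K - hval l e else l K)"
      have l': "hval l' v = hval l v - hval l e * of_bool (v \<in> H)" for v
        using hval_fun_diff[of "{H}" l "\<lambda>_. hval l e" v] H by (simp add: l'_def)
      have "hval l' v = 0" if v: "v \<noteq> 0" "v \<notin> \<Union>\<F>" for v
      proof (cases "v \<in> H")
        case True
        have "hval l v = hval l e"
          using insert.prems insert.hyps True v e
          by (intro equal_on_simple_points[OF card m insert.prems(1,2), of l H]) auto
        then show ?thesis using True by (simp add: l')
      next
        case False
        then show ?thesis using insert.prems(3)[of v] v by (simp add: l')
      qed
      from insert.IH[OF \<F> this] obtain b
        where b: "\<And>v. v \<noteq> 0 \<Longrightarrow> hval l' v = (\<Sum>K\<in>\<F>. b K * of_bool (v \<in> K))" by blast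
      show ?thesis
      proof (intro exI[of _ "b(H := hval l e)"] allI impI)
        fix v :: "'a ^ 'n" assume "v \<noteq> 0"
        have eq: "(\<Sum>K\<in>\<F>. (b(H := hval l e)) K * of_bool (v \<in> K)) = (\<Sum>K\<in>\<F>. b K * of_bool (v \<in> K))"
          using insert.hyps by (intro sum.cong) auto
        show "hval l v = (\<Sum>K\<in>insert H \<F>. (b(H := hval l e)) K * of_bool (v \<in> K))"
          unfolding sum.insert[OF insert.hyps(1,2)] eq b[OF \<open>v \<noteq> 0\<close>, symmetric] by (simp add: l' algebra_simps)
      qed
    next
      case False
      then have "hval l v = 0" if "v \<noteq> 0" "v \<notin> \<Union>\<F>" for v
        using that insert.prems(3)[of v] by auto
      from insert.IH[OF \<F> this] obtain b
        where b: "\<And>v. v \<noteq> 0 \<Longrightarrow> hval l v = (\<Sum>K\<in>\<F>. b K * of_bool (v \<in> K))" by blast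
      show ?thesis
      proof (intro exI[of _ "b(H := 0)"] allI impI)
        fix v :: "'a ^ 'n" assume "v \<noteq> 0"
        have eq: "(\<Sum>K\<in>\<F>. (b(H := 0)) K * of_bool (v \<in> K)) = (\<Sum>K\<in>\<F>. b K * of_bool (v \<in> K))"
          using insert.hyps by (intro sum.cong) auto
        show "hval l v = (\<Sum>K\<in>insert H \<F>. (b(H := 0)) K * of_bool (v \<in> K))"
          unfolding sum.insert[OF insert.hyps(1,2)] eq b[OF \<open>v \<noteq> 0\<close>, symmetric] by simp
      qed
    qed
  qed
qed

section \<open>From vectors back to functions on points\<close>

lemma pg_pointE:
  assumes "P \<in> pg_points"
  obtains v where "v \<noteq> 0" "P = vec.span {v}"
proof -
  have "vec.dim P = 1" "vec.subspace P" using assms by (auto simp: pg_points_def)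
  then obtain B where B: "B \<subseteq> P" "vec.independent B" "P \<subseteq> vec.span B" "card B = 1"
    using vec.basis_exists[of P] by metis
  then obtain v where "B = {v}" by (auto simp: card_1_singleton_iff)
  with B \<open>vec.subspace P\<close> have "P = vec.span {v}" "v \<noteq> 0"
    using vec.span_minimal[of B P] vec.dependent_zero[of B] by auto
  then show thesis using that by blast
qed

lemma span_in_pg_points: "v \<noteq> 0 \<Longrightarrow> vec.span {v} \<in> pg_points"
  for v :: "'a::field ^ 'n"
  using vec.dim_insert[of v "{}"] by (simp add: pg_points_def)

lemma span_subset_hyperplane:
  "H \<in> pg_hyperplanes \<Longrightarrow> vec.span {v} \<subseteq> H \<longleftrightarrow> v \<in> H"
  using vec.span_minimal[of "{v}" H] vec.span_base[of v "{v}"]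
  by (auto simp: pg_hyperplanes_def)

lemma hchar_span:
  "H \<in> pg_hyperplanes \<Longrightarrow> v \<noteq> 0 \<Longrightarrow> hchar H (vec.span {v}) = of_bool (v \<in> H)"
  by (simp add: hchar_def span_in_pg_points span_subset_hyperplane)

lemma sum_fscale_apply: "(\<Sum>H\<in>A. fscale (f H) (g H)) P = (\<Sum>H\<in>A. f H * g H P)"
  by (induction A rule: infinite_finite_induct) (auto simp: fscale_def)

lemma pg_code_hyperplane_sum:
  fixes c :: "('a::{field,finite} ^ 'n) set \<Rightarrow> 'f::field"
  assumes "c \<in> pg_code"
  shows "\<exists>l. c = (\<Sum>H\<in>pg_hyperplanes. fscale (l H) (hchar H))"
  using assms unfolding pg_code_def
proof (induction rule: fun_space.span_induct_alt)
  case base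
  show ?case by (intro exI[of _ "\<lambda>_. 0"]) (simp add: fun_eq_iff sum_fscale_apply)
next
  case (step k x y)
  then obtain l K where l: "y = (\<Sum>H\<in>pg_hyperplanes. fscale (l H) (hchar H))"
    and K: "K \<in> pg_hyperplanes" "x = hchar K" by auto
  have "(\<Sum>H\<in>pg_hyperplanes. (l H + (if H = K then k else 0)) * hchar H P)
      = k * hchar K P + (\<Sum>H\<in>pg_hyperplanes. l H * hchar H P)" for P
  proof -
    have "(\<Sum>H\<in>pg_hyperplanes. (if H = K then k else 0) * hchar H P)
        = (\<Sum>H\<in>pg_hyperplanes. if H = K then k * hchar H P else 0)"
      by (rule sum.cong) auto
    also have "\<dots> = k * hchar K P" using K by simp
    finally show ?thesis by (simp add: distrib_right sum.distrib)
  qed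
  then have "fscale k x + y = (\<Sum>H\<in>pg_hyperplanes. fscale (l H + (if H = K then k else 0)) (hchar H))"
    by (simp add: fun_eq_iff sum_fscale_apply l K(2)) (simp add: fscale_def)
  then show ?case by (intro exI[of _ "\<lambda>H. l H + (if H = K then k else 0)"])
qed

text \<open>Every point is the span of a nonzero vector, so the statement about \<open>hval\<close>
  transfers; at arguments that are not points both sides are 0.\<close>

lemma codeword_in_span:
  fixes c :: "('a::{field,finite} ^ 'n) set \<Rightarrow> 'f::{field,finite}"
  assumes card: "CARD('f) = p" "CARD('a) = p ^ h" "prime p"
    and m: "m * (m + 1) < CARD('a)" "p * (m - 1) < CARD('a)" "3 * m \<le> CARD('a) + 1"
    and \<H>: "\<H> \<subseteq> pg_hyperplanes" "card \<H> \<le> m"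
    and c: "c \<in> pg_code" "supp c \<subseteq> {P. \<exists>H\<in>\<H>. P \<subseteq> H}"
  shows "\<exists>b. c = (\<Sum>H\<in>\<H>. fscale (b H) (hchar H))"
proof -
  obtain l where l: "c = (\<Sum>H\<in>pg_hyperplanes. fscale (l H) (hchar H))"
    using pg_code_hyperplane_sum[OF c(1)] by blast
  have hval: "c (vec.span {v}) = hval l v" if "v \<noteq> 0" for v
    unfolding l sum_fscale_apply hval_def using that by (intro sum.cong) (auto simp: hchar_span)
  have "hval l v = 0" if "v \<noteq> 0" "v \<notin> \<Union>\<H>" for v
  proof (rule ccontr)
    assume "hval l v \<noteq> 0"
    then have "vec.span {v} \<in> supp c"
      using hval[OF that(1)] span_in_pg_points[OF that(1)] by (simp add: supp_def)
    then obtain H where "H \<in> \<H>" "vec.span {v} \<subseteq> H" using c(2) by blast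
    then show False using that(2) vec.span_base[of v "{v}"] by auto
  qed
  from codeword_supported_on_hyperplanes[OF card m \<H> this] obtain b
    where b: "\<And>v. v \<noteq> 0 \<Longrightarrow> hval l v = (\<Sum>H\<in>\<H>. b H * of_bool (v \<in> H))" by blast
  have "c P = (\<Sum>H\<in>\<H>. b H * hchar H P)" for P
  proof (cases "P \<in> pg_points")
    case True
    then obtain v where v: "v \<noteq> 0" "P = vec.span {v}" by (rule pg_pointE)
    have "(\<Sum>H\<in>\<H>. b H * hchar H P) = (\<Sum>H\<in>\<H>. b H * of_bool (v \<in> H))"
      using v \<H>(1) by (intro sum.cong) (auto simp: hchar_span)
    then show ?thesis using hval[OF v(1)] b[OF v(1)] v(2) by simp
  next
    case False
    then show ?thesis by (simp add: l sum_fscale_apply hchar_def)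
  qed
  then show ?thesis by (auto simp: fun_eq_iff sum_fscale_apply)
qed

section \<open>The sequence of partitions\<close>

lemma sym_part_edges: "sym (part_edges c \<P>)"
  by (auto simp: sym_def part_edges_def insert_commute)

lemma rtrancl_in_vertices:
  assumes "(X, Y) \<in> (part_edges c \<P>)\<^sup>*" "X \<in> \<P>"
  shows "Y \<in> \<P>"
  using assms by (induction rule: rtrancl_induct) (auto simp: part_edges_def)

lemma part_step_image: "part_step c \<P> = (\<lambda>X. \<Union>((part_edges c \<P>)\<^sup>* `` {X})) ` \<P>"
  by (auto simp: part_step_def quotient_def)

lemma component_eq:
  assumes "(X, Y) \<in> (part_edges c \<P>)\<^sup>*"
  shows "(part_edges c \<P>)\<^sup>* `` {X} = (part_edges c \<P>)\<^sup>* `` {Y}"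
proof -
  have "(Y, X) \<in> (part_edges c \<P>)\<^sup>*"
    using symD[OF sym_rtrancl[OF sym_part_edges] assms] .
  then have "(X, Z) \<in> (part_edges c \<P>)\<^sup>* \<longleftrightarrow> (Y, Z) \<in> (part_edges c \<P>)\<^sup>*" for Z
    using assms rtrancl_trans by metis
  then show ?thesis by auto
qed

text \<open>A hyperplane common to two of the unions lies in a single old part, since old parts are
  disjoint. The two components share this vertex and therefore coincide.\<close>

lemma partition_on_part_step:
  assumes "partition_on A \<P>"
  shows "partition_on A (part_step c \<P>)"
proof (rule partition_onI)
  let ?R = "(part_edges c \<P>)\<^sup>*"
  have "\<Union>(part_step c \<P>) = \<Union>\<P>"
    unfolding part_step_image using rtrancl_in_vertices[of _ _ c \<P>] by blast
  then show "\<Union>(part_step c \<P>) = A" using partition_onD1[OF assms] by simp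
  show "{} \<notin> part_step c \<P>"
  proof
    assume "{} \<in> part_step c \<P>"
    then obtain X where "X \<in> \<P>" "{} = \<Union>(?R `` {X})" unfolding part_step_image by blast
    moreover have "X \<in> ?R `` {X}" by simp
    ultimately have "X = {}" by blast
    then show False using partition_onD3[OF assms] \<open>X \<in> \<P>\<close> by simp
  qed
  fix X Y assume "X \<in> part_step c \<P>" "Y \<in> part_step c \<P>" "X \<noteq> Y"
  then obtain X' Y' where X': "X' \<in> \<P>" "X = \<Union>(?R `` {X'})" and Y': "Y' \<in> \<P>" "Y = \<Union>(?R `` {Y'})"
    unfolding part_step_image by blast
  show "disjnt X Y"
    unfolding disjnt_def
  proof (rule ccontr)
    assume "X \<inter> Y \<noteq> {}"
    then obtain H Z\<^sub>1 Z\<^sub>2 where Z: "H \<in> Z\<^sub>1" "H \<in> Z\<^sub>2" "(X', Z\<^sub>1) \<in> ?R" "(Y', Z\<^sub>2) \<in> ?R"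
      using X' Y' by auto
    have "Z\<^sub>1 \<in> \<P>" "Z\<^sub>2 \<in> \<P>"
      by (rule rtrancl_in_vertices[OF Z(3) X'(1)], rule rtrancl_in_vertices[OF Z(4) Y'(1)])
    then have "Z\<^sub>1 = Z\<^sub>2"
      using disjointD[OF partition_onD2[OF assms], of Z\<^sub>1 Z\<^sub>2] Z(1,2) by blast
    then have "?R `` {X'} = ?R `` {Y'}" using component_eq[OF Z(3)] component_eq[OF Z(4)] by simp
    then show False using X' Y' \<open>X \<noteq> Y\<close> by simp
  qed
qed

lemma part_seq_Suc: "part_seq c (Suc i) = part_step c (part_seq c i)"
  by (simp add: part_seq_def)

lemma partition_on_part_seq: "partition_on (hyp_set c) (part_seq c i)"
proof (induction i)
  case 0
  show ?case unfolding part_seq_def funpow_0 by (rule partition_onI) (auto simp: disjnt_def)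
next
  case (Suc i)
  then show ?case unfolding part_seq_Suc by (rule partition_on_part_step)
qed

lemma card_part_step_le: "finite \<P> \<Longrightarrow> card (part_step c \<P>) \<le> card \<P>"
  unfolding part_step_image by (rule card_image_le)

text \<open>An edge would merge two parts and so lower the number of parts.\<close>

lemma part_step_stable:
  assumes "finite \<P>" "card (part_step c \<P>) = card \<P>"
  shows "part_step c \<P> = \<P>"
proof -
  have inj: "inj_on (\<lambda>X. \<Union>((part_edges c \<P>)\<^sup>* `` {X})) \<P>"
    by (rule eq_card_imp_inj_on[OF assms(1) assms(2)[unfolded part_step_image]])
  have "part_edges c \<P> = {}"
  proof (rule ccontr)
    assume "part_edges c \<P> \<noteq> {}"
    then obtain X Y where XY: "(X, Y) \<in> part_edges c \<P>" by fast
    then have mem: "X \<in> \<P>" "Y \<in> \<P>" and "X \<noteq> Y" by (simp_all add: part_edges_def)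
    have "\<Union>((part_edges c \<P>)\<^sup>* `` {X}) = \<Union>((part_edges c \<P>)\<^sup>* `` {Y})"
      unfolding component_eq[OF r_into_rtrancl[OF XY]] ..
    from inj_onD[OF inj this mem] \<open>X \<noteq> Y\<close> show False by blast
  qed
  then show ?thesis unfolding part_step_image by simp
qed

text \<open>The number of parts never increases. From an index where it is minimal the sequence is
  constant, which identifies the limit.\<close>

lemma part_limit_eq_part_seq:
  fixes c :: "('a::{field,finite} ^ 'n) set \<Rightarrow> 'f::field"
  shows "\<exists>i. part_limit c = part_seq c i"
proof -
  obtain i where i: "\<And>j. card (part_seq c i) \<le> card (part_seq c j)"
    using ex_has_least_nat[of "\<lambda>_. True" 0 "\<lambda>i. card (part_seq c i)"] by auto
  have "card (part_seq c (Suc i)) = card (part_seq c i)"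
    unfolding part_seq_Suc using card_part_step_le[of "part_seq c i" c] i[of "Suc i"]
    by (simp add: part_seq_Suc)
  then have stable: "part_step c (part_seq c i) = part_seq c i"
    unfolding part_seq_Suc by (intro part_step_stable) auto
  have "part_seq c j = part_seq c i" if "j \<ge> i" for j
    using that by (induction rule: dec_induct) (simp_all add: part_seq_Suc stable)
  then have ev: "\<forall>\<^sub>F j in sequentially. part_seq c j = part_seq c i"
    unfolding eventually_sequentially by blast
  have "part_limit c = part_seq c i"
    unfolding part_limit_def
  proof (rule the_equality)
    show "\<forall>\<^sub>F j in sequentially. part_seq c j = part_seq c i" by (rule ev)
    fix \<P> assume "\<forall>\<^sub>F j in sequentially. part_seq c j = \<P>"
    with ev have "\<forall>\<^sub>F j in sequentially. \<P> = part_seq c i" by eventually_elim simp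
    then show "\<P> = part_seq c i" by simp
  qed
  then show ?thesis by blast
qed

lemma part_limit_singleton:
  fixes c :: "('a::{field,finite} ^ 'n) set \<Rightarrow> 'f::field"
  assumes "card (part_limit c) = 1"
  obtains i where "part_seq c i = {hyp_set c}" "hyp_set c \<noteq> {}"
proof -
  obtain i where i: "part_limit c = part_seq c i" using part_limit_eq_part_seq by blast
  then obtain X where X: "part_seq c i = {X}" using assms by (auto simp: card_1_singleton_iff)
  have "partition_on (hyp_set c) {X}" using partition_on_part_seq[of c i] X by simp
  then have "X = hyp_set c" "X \<noteq> {}" by (auto simp: partition_on_def)
  then show thesis using that X by blast
qed

text \<open>The default value 0 of \<open>hyp_coeff\<close> would make \<open>hyp_set c\<close>
  empty, so a nonempty \<open>hyp_set c\<close> certifies a unique representation.\<close>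

lemma hyp_rep_hyp_coeff:
  assumes "hyp_set c \<noteq> {}"
  shows "hyp_rep c (hyp_coeff c)"
proof -
  have ex: "\<exists>!a. hyp_rep c a"
  proof (rule ccontr)
    assume "\<not> ?thesis"
    then have "hyp_coeff c = (\<lambda>_. 0)" unfolding hyp_coeff_def by (rule if_not_P)
    then show False using assms by (simp add: hyp_set_def)
  qed
  show ?thesis unfolding hyp_coeff_def if_P[OF ex] by (rule theI'[OF ex])
qed

text \<open>At a hole witnessing an edge between X and Y both \<open>c\<close> and the combination with coefficients
  \<open>b\<close> vanish, and X and Y are the only parts that contribute, so the two ratios agree.\<close>

lemma part_step_proportional:
  fixes c :: "('a::{field,finite} ^ 'n) set \<Rightarrow> 'f::field"
  assumes part: "partition_on (hyp_set c) \<P>"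
    and c: "\<And>P. P \<in> holes c \<Longrightarrow> (\<Sum>H\<in>hyp_set c. hyp_coeff c H * hchar H P) = 0"
    and b: "\<And>P. P \<in> holes c \<Longrightarrow> (\<Sum>H\<in>hyp_set c. b H * hchar H P) = 0"
    and ratio: "\<forall>X\<in>\<P>. \<exists>\<alpha>. \<forall>H\<in>X. b H = \<alpha> * hyp_coeff c H"
  shows "\<forall>X\<in>part_step c \<P>. \<exists>\<alpha>. \<forall>H\<in>X. b H = \<alpha> * hyp_coeff c H"
proof -
  from bchoice[OF ratio] obtain \<alpha>
    where \<alpha>: "\<And>X H. X \<in> \<P> \<Longrightarrow> H \<in> X \<Longrightarrow> b H = \<alpha> X * hyp_coeff c H" by blast
  have restr: "restr c X P = (\<Sum>H\<in>X. hyp_coeff c H * hchar H P)" for X P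
    by (simp add: restr_def sum_fscale_apply)
  have split: "(\<Sum>H\<in>hyp_set c. f H) = (\<Sum>X\<in>\<P>. \<Sum>H\<in>X. f H)" for f :: "_ \<Rightarrow> 'f"
    unfolding partition_onD1[OF part]
    using partition_onD2[OF part] by (subst sum.Union_disjoint) (auto simp: disjoint_def)
  have edge: "\<alpha> X = \<alpha> Y" if XY: "(X, Y) \<in> part_edges c \<P>" for X Y
  proof -
    obtain P where P: "P \<in> holes c" "restr c X P \<noteq> 0"
      and others: "\<forall>Z\<in>\<P> - {X, Y}. restr c Z P = 0"
      and in_\<P>: "X \<in> \<P>" "Y \<in> \<P>" "X \<noteq> Y"
      using XY by (auto simp: part_edges_def)
    have two: "(\<Sum>Z\<in>\<P>. g Z * restr c Z P) = g X * restr c X P + g Y * restr c Y P" for g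
    proof -
      have "(\<Sum>Z\<in>\<P>. g Z * restr c Z P) = (\<Sum>Z\<in>{X, Y}. g Z * restr c Z P)"
        using in_\<P> others by (intro sum.mono_neutral_right) auto
      then show ?thesis using in_\<P> by simp
    qed
    have "restr c X P + restr c Y P = 0"
      using c[OF P(1)] two[of "\<lambda>_. 1"] by (simp add: split restr)
    then have Y: "restr c Y P = - restr c X P" by (simp add: eq_neg_iff_add_eq_0 add.commute)
    have "(\<Sum>H\<in>Z. b H * hchar H P) = \<alpha> Z * restr c Z P" if "Z \<in> \<P>" for Z
      unfolding restr sum_distrib_left using \<alpha>[OF that] by (intro sum.cong) (auto simp: mult.assoc)
    then have "\<alpha> X * restr c X P + \<alpha> Y * restr c Y P = 0"
      using b[OF P(1)] two[of \<alpha>] by (simp add: split)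
    then have "(\<alpha> X - \<alpha> Y) * restr c X P = 0" by (simp add: Y algebra_simps)
    then show ?thesis using P(2) by simp
  qed
  have connected: "\<alpha> X = \<alpha> Y" if "(X, Y) \<in> (part_edges c \<P>)\<^sup>*" for X Y
    using that by (induction rule: rtrancl_induct) (auto dest: edge)
  show ?thesis
  proof
    fix Z assume "Z \<in> part_step c \<P>"
    then obtain X where X: "X \<in> \<P>" "Z = \<Union>((part_edges c \<P>)\<^sup>* `` {X})"
      by (auto simp: part_step_image)
    have "b H = \<alpha> X * hyp_coeff c H" if "H \<in> Z" for H
      using that X \<alpha> connected rtrancl_in_vertices[of X _ c \<P>] by fastforce
    then show "\<exists>\<alpha>. \<forall>H\<in>Z. b H = \<alpha> * hyp_coeff c H" by blast
  qed
qed

section \<open>The weight bound and minimality\<close>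

text \<open>Dividing the weight bound by theta gives \<open>m + 1 \<le> Delta p h n\<close>, and
  Delta is at most the square root of q: directly for h > 2, and because it is at most p for h =
  2.\<close>

lemma mnum_bound:
  fixes p h q n m :: nat
  assumes p: "p \<ge> 2" and h: "h \<ge> 2" and q: "q = p ^ h" and n: "n \<ge> 2"
    and wt: "int k \<le> Wbound p h n"
    and m: "m = nat \<lceil>real k / real (theta q (n - 1))\<rceil>"
  shows "(m + 1) ^ 2 \<le> q"
proof -
  define t where "t = theta q (n - 1)"
  have "p ^ 1 \<le> p ^ h" using p h by (intro power_increasing) auto
  then have "q \<ge> 2" using p q by simp
  then have "q ^ 1 \<le> q ^ n" using n by (intro power_increasing) auto
  then have "(q - 1) div (q - 1) \<le> t"
    unfolding t_def theta_def using n by (intro div_le_mono) simp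
  then have t: "t > 0" using \<open>q \<ge> 2\<close> by simp
  have W: "int k \<le> (Delta p h n - 1) * int t" using wt by (simp add: Wbound_def q t_def)
  then have "0 \<le> (Delta p h n - 1) * int t" by linarith
  \<comment> \<open>A weight is nonnegative, so Delta - 1 cannot be negative and \<open>nat\<close>
    does not truncate the bound.\<close>
  then have \<Delta>: "Delta p h n \<ge> 1" using t by (simp add: zero_le_mult_iff)
  have "real k \<le> of_int (Delta p h n - 1) * real t"
    using W by (metis of_int_le_iff of_int_mult of_int_of_nat_eq)
  then have "real k / real t \<le> of_int (Delta p h n - 1)" using t by (simp add: divide_le_eq)
  then have "\<lceil>real k / real t\<rceil> \<le> Delta p h n - 1" by (rule ceiling_le)
  then have "int m \<le> Delta p h n - 1" using \<Delta> by (simp add: m t_def)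
  then have m\<Delta>: "int (m + 1) \<le> Delta p h n" by simp
  show ?thesis
  proof (cases "h > 2")
    case True
    then have "real (m + 1) \<le> sqrt (real q) / 2 ^ (n - 2)"
      using m\<Delta> by (simp add: Delta_def le_floor_iff q)
    also have "\<dots> \<le> sqrt (real q) / 1" by (intro divide_left_mono) auto
    finally have "(real (m + 1))\<^sup>2 \<le> (sqrt (real q))\<^sup>2" by (intro power_mono) auto
    then have "real ((m + 1)\<^sup>2) \<le> real q" by simp
    then show ?thesis by (simp only: of_nat_le_iff)
  next
    case False
    then have "real (m + 1) \<le> real p / 2 ^ n"
      using m\<Delta> by (simp add: Delta_def le_floor_iff)
    also have "\<dots> \<le> real p / 1" by (intro divide_left_mono) auto
    finally have "m + 1 \<le> p" by simp
    then have "(m + 1)\<^sup>2 \<le> p\<^sup>2" by (intro power_mono) auto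
    then show ?thesis using False h q by simp
  qed
qed

theorem theorem3p7:
  fixes c :: "('a::{field,finite} ^ 'n) set \<Rightarrow> 'f::{field,finite}"
    and p h q n :: nat
  assumes "prime p" and "h \<ge> 2" and "q = p ^ h" and "q > 27" and "n \<ge> 2"
    and "h > 2 \<Longrightarrow> q \<ge> max 32 (2 ^ (2 * n - 4))"
    and "h = 2 \<Longrightarrow> q \<ge> 2 ^ (2 * n)"
    and "CARD('a) = q" and "CARD('f) = p" and "CARD('n) = n + 1"
    and "c \<in> pg_code"
    and "int (wt c) \<le> Wbound p h n"
    and "card (part_limit c) = 1"
  shows "minimal_codeword c"
  unfolding minimal_codeword_def
proof (intro ballI impI)
  fix c' :: "('a ^ 'n) set \<Rightarrow> 'f"
  assume c': "c' \<in> pg_code" "supp c' \<subseteq> supp c"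
  obtain i where i: "part_seq c i = {hyp_set c}" and ne: "hyp_set c \<noteq> {}"
    using part_limit_singleton[OF \<open>card (part_limit c) = 1\<close>] by blast
  define m where "m = mnum c"
  have rep: "hyp_set c \<subseteq> pg_hyperplanes" "card (hyp_set c) = m"
    "c = (\<Sum>H\<in>hyp_set c. fscale (hyp_coeff c H) (hchar H))"
    using hyp_rep_hyp_coeff[OF ne] unfolding hyp_rep_def hyp_set_def m_def by auto
  have p: "p \<ge> 2" using \<open>prime p\<close> by (rule prime_ge_2_nat)
  have m: "(m + 1)\<^sup>2 \<le> q"
    using assms by (intro mnum_bound[OF p _ _ _ \<open>int (wt c) \<le> Wbound p h n\<close>]) (auto simp: m_def mnum_def)
  have "p\<^sup>2 \<le> q" unfolding \<open>q = p ^ h\<close> using p \<open>h \<ge> 2\<close> by (intro power_increasing) auto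
  have "m * m + 2 * m + 1 \<le> q" using m by (simp add: power2_eq_square algebra_simps)
  then have m1: "m * (m + 1) < q" and m3: "3 * m \<le> q + 1"
    using le_square[of m] unfolding distrib_left by linarith+
  \<comment> \<open>Multiply p^2 \<le> q by (m - 1)^2 < (m + 1)^2 \<le> q and compare
    squares.\<close>
  have "p * (m - 1) < q"
  proof (rule power2_less_imp_less)
    have "(m - 1)\<^sup>2 < (m + 1)\<^sup>2" by (intro power_strict_mono) auto
    then have "p\<^sup>2 * (m - 1)\<^sup>2 < q * q"
      using m \<open>p\<^sup>2 \<le> q\<close> p by (intro mult_le_less_imp_less) auto
    then show "(p * (m - 1))\<^sup>2 < q\<^sup>2" by (simp only: power_mult_distrib power2_eq_square[of q])
  qed simp
  note bounds = m1 this m3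
  have "supp c \<subseteq> {P. \<exists>H\<in>hyp_set c. P \<subseteq> H}"
  proof
    fix P assume "P \<in> supp c"
    then have "(\<Sum>H\<in>hyp_set c. hyp_coeff c H * hchar H P) \<noteq> 0"
      by (subst (asm) rep(3)) (simp add: supp_def sum_fscale_apply)
    then obtain H where "H \<in> hyp_set c" "hyp_coeff c H * hchar H P \<noteq> 0"
      by (meson sum.neutral)
    then show "P \<in> {P. \<exists>H\<in>hyp_set c. P \<subseteq> H}" by (auto simp: hchar_def split: if_splits)
  qed
  then have "\<exists>b. c' = (\<Sum>H\<in>hyp_set c. fscale (b H) (hchar H))"
    using assms c' rep bounds by (intro codeword_in_span[of p h m]) auto
  then obtain b where b: "c' = (\<Sum>H\<in>hyp_set c. fscale (b H) (hchar H))" by blast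
  \<comment> \<open>Holes of \<open>c\<close> are also zeros of \<open>c'\<close> because
    \<open>supp c' \<subseteq> supp c\<close>.\<close>
  have hole: "(\<Sum>H\<in>hyp_set c. hyp_coeff c H * hchar H P) = 0" "(\<Sum>H\<in>hyp_set c. b H * hchar H P) = 0"
    if "P \<in> holes c" for P
  proof -
    have "c P = 0" "c' P = 0" using that c'(2) by (auto simp: holes_def supp_def)
    then show "(\<Sum>H\<in>hyp_set c. hyp_coeff c H * hchar H P) = 0" "(\<Sum>H\<in>hyp_set c. b H * hchar H P) = 0"
      by (simp_all add: b sum_fscale_apply) (subst (asm) rep(3), simp add: sum_fscale_apply)
  qed
  have "\<forall>X\<in>part_seq c j. \<exists>\<alpha>. \<forall>H\<in>X. b H = \<alpha> * hyp_coeff c H" for j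
  proof (induction j)
    case 0
    \<comment> \<open>The initial parts are singletons, and members of \<open>hyp_set c\<close> have
      nonzero coefficients, so the quotient is the ratio.\<close>
    have "\<exists>\<alpha>. b H = \<alpha> * hyp_coeff c H" if "H \<in> hyp_set c" for H
      using that by (intro exI[of _ "b H / hyp_coeff c H"]) (simp add: hyp_set_def)
    then show ?case by (auto simp: part_seq_def)
  next
    case (Suc j)
    then show ?case
      unfolding part_seq_Suc
      by (intro part_step_proportional[OF partition_on_part_seq hole])
  qed
  \<comment> \<open>At index \<open>i\<close> the only part is \<open>hyp_set c\<close>, so one
    ratio serves all hyperplanes.\<close>
  from this[of i] i obtain \<alpha> where \<alpha>: "\<And>H. H \<in> hyp_set c \<Longrightarrow> b H = \<alpha> * hyp_coeff c H" by auto
  have "c' P = fscale \<alpha> c P" for P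
  proof -
    have "c' P = (\<Sum>H\<in>hyp_set c. b H * hchar H P)" by (simp add: b sum_fscale_apply)
    also have "\<dots> = (\<Sum>H\<in>hyp_set c. \<alpha> * (hyp_coeff c H * hchar H P))"
      by (intro sum.cong) (simp_all add: \<alpha> mult.assoc)
    also have "\<dots> = \<alpha> * c P"
      by (subst (3) rep(3)) (simp only: sum_fscale_apply sum_distrib_left)
    finally show ?thesis by (simp only: fscale_def)
  qed
  then show "\<exists>\<alpha>. c' = fscale \<alpha> c" by blast
qed

end
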